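(* Suppose that a point $\lambda_0\in\mathbb{C}$ is a point of analyticity of $M_B$, that $\lambda_0$ is at worst an isolated singularity of $\lambda\mapsto(A_B-\lambda I)^{-1}$, and that the resolvent set $\rho(\tilde{A}_{B^*})$ has finitely many connected components. Let $P_{\overline{\mathcal{S}}}$ and $P_{\overline{\tilde{\mathcal{S}}}}$ denote the orthogonal projections onto the closures of $\mathcal{S}$ and $\tilde{\mathcal{S}}$ respectively. Then $P_{\overline{\tilde{\mathcal{S}}}}(A_B-\lambda I)^{-1}P_{\overline{\mathcal{S}}}$ is analytic at $\lambda=\lambda_0$.
   Context: $H$ is a complex Hilbert space; $A$ and $\tilde{A}$ are closed, densely defined operators in $H$ forming an adjoint pair, i.e. $A^*\supseteq\tilde{A}$ and $\tilde{A}^*\supseteq A$. A boundary triplet for this pair is fixed: Hilbert spaces $\mathcal{H},\mathcal{K}$ and linear operators $\Gamma_1:D(\tilde{A}^* )\to\mathcal{H}$, $\Gamma_2:D(\tilde{A}^* )\to\mathcal{K}$, $\tilde{\Gamma}_1:D(A^* )\to\mathcal{K}$, $\tilde{\Gamma}_2:D(A^* )\to\mathcal{H}$, bounded with respect to the graph norms, such that $(\Gamma_1,\Gamma_2)$ is surjective onto $\mathcal{H}\times\mathcal{K}$, $(\tilde{\Gamma}_1,\tilde{\Gamma}_2)$ is surjective onto $\mathcal{K}\times\mathcal{H}$, $D(A)=D(\tilde{A}^* )\cap\ker\Gamma_1\cap\ker\Gamma_2$, $D(\tilde{A})=D(A^* )\cap\ker\tilde{\Gamma}_1\cap\ker\tilde{\Gamma}_2$,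 and for all $u\in D(\tilde{A}^* )$, $v\in D(A^* )$ $$(\tilde{A}^*u,v)_H-(u,A^*v)_H=(\Gamma_1u,\tilde{\Gamma}_2v)_{\mathcal{H}}-(\Gamma_2u,\tilde{\Gamma}_1v)_{\mathcal{K}}.$$ Let $B:\mathcal{K}\to\mathcal{H}$ be a bounded linear operator, $A_B:=\tilde{A}^*|_{\ker(\Gamma_1-B\Gamma_2)}$ and $\tilde{A}_{B^*}:=A^*|_{\ker(\tilde{\Gamma}_1-B^*\tilde{\Gamma}_2)}$ (it is known that $\tilde{A}_{B^*}=(A_B)^*$). Assume $\rho(A_B)\neq\emptyset$. For $\lambda\in\rho(A_B)$, the $M$-function $M_B(\lambda):\mathrm{Ran}(\Gamma_1-B\Gamma_2)\to\mathcal{K}$ is the operator with $M_B(\lambda)(\Gamma_1-B\Gamma_2)u=\Gamma_2u$ for all $u\in\ker(\tilde{A}^*-\lambda)$; it is analytic on $\rho(A_B)$. A point $\lambda_0\in\mathbb{C}$ is called a point of analyticity of $M_B$ if all analytic continuations of $M_B$ coincide in a neighbourhood of $\lambda_0$ (so that $M_B$ is given near $\lambda_0$ by a single function analytic in a neighbourhood of $\lambda_0$). That $\lambda_0$ is at worst an isolated singularity of the resolvent means that some punctured neighbourhood of $\lambda_0$ is contained in $\rho(A_B)$. "Analytic at $\lambda_0$" for the bordered resolvent, defined for $\lambda\in\rho(A_B)$, means that it extends analytically to a neighbourhood of $\lambda_0$. The solution operators are $S_{\mu,B}=\left((\Gamma_1-B\Gamma_2)|_{\ker(\tilde{A}^*-\mu)}\right)^{-1}$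 for $\mu\in\rho(A_B)$ and $\tilde{S}_{\mu,B^*}=\left((\tilde{\Gamma}_1-B^*\tilde{\Gamma}_2)|_{\ker(A^*-\mu)}\right)^{-1}$ for $\mu\in\rho(\tilde{A}_{B^*})$. Fix $\mu_0\notin\sigma(A_B)$ and $\tilde{\mu}\notin\sigma(\tilde{A}_{B^*})$ and define, with $\mathrm{Span}$ denoting the set of finite linear combinations of vectors from the indicated sets, $$\mathcal{S}=\mathrm{Span}_{\delta\notin\sigma(A_B)}(A_B-\delta I)^{-1}\mathrm{Ran}(S_{\mu_0,B}),\qquad \tilde{\mathcal{S}}=\mathrm{Span}_{\delta\notin\sigma(\tilde{A}_{B^*})}(\tilde{A}_{B^*}-\delta I)^{-1}\mathrm{Ran}(\tilde{S}_{\tilde{\mu},B^*}).$$ *)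

theory Defs
  imports "HOL-Analysis.Analysis"
begin

section \<open>Complex Hilbert spaces\<close>

text \<open>The topology, norm and completeness are those of the underlying real Hilbert space, whose
  inner product is the real part of the complex one.  The complex inner product is linear in the
  \<^emph>\<open>first\<close> argument.\<close>

class complex_inner = real_inner +
  fixes scaleC :: "complex \<Rightarrow> 'a \<Rightarrow> 'a"  (infixr "*\<^sub>C" 75)
    and cinner :: "'a \<Rightarrow> 'a \<Rightarrow> complex"
  assumes scaleC_add_right: "a *\<^sub>C (x + y) = a *\<^sub>C x + a *\<^sub>C y"
    and scaleC_add_left: "(a + b) *\<^sub>C x = a *\<^sub>C x + b *\<^sub>C x"
    and scaleC_scaleC: "a *\<^sub>C (b *\<^sub>C x) = (a * b) *\<^sub>C x"
    and scaleC_of_real: "complex_of_real r *\<^sub>C x = r *\<^sub>R x"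
    and cinner_add_left: "cinner (x + y) z = cinner x z + cinner y z"
    and cinner_scaleC_left: "cinner (a *\<^sub>C x) y = a * cinner x y"
    and cinner_commute: "cinner y x = cnj (cinner x y)"
    and inner_eq_Re_cinner: "x \<bullet> y = Re (cinner x y)"

class chilbert_space = complex_inner + complete_space

global_interpretation complex_vector: vector_space "scaleC :: complex \<Rightarrow> 'a \<Rightarrow> 'a::complex_inner"
  defines csubspace = complex_vector.subspace
    and cspan = complex_vector.span
proof
  show "1 *\<^sub>C x = x" for x :: 'a
    using scaleC_of_real[of 1 x] by simp
qed (auto simp: scaleC_add_right scaleC_add_left scaleC_scaleC)

instantiation complex :: chilbert_space
begin
definition scaleC_complex :: "complex \<Rightarrow> complex \<Rightarrow> complex" where "scaleC_complex a x = a * x"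
definition cinner_complex :: "complex \<Rightarrow> complex \<Rightarrow> complex" where "cinner_complex x y = x * cnj y"
instance
  by standard
    (auto simp: scaleC_complex_def cinner_complex_def algebra_simps scaleR_conv_of_real
      inner_complex_def)
end

instantiation prod :: (complex_inner, complex_inner) complex_inner
begin
definition scaleC_prod :: "complex \<Rightarrow> 'a \<times> 'b \<Rightarrow> 'a \<times> 'b"
  where "scaleC_prod a p = (a *\<^sub>C fst p, a *\<^sub>C snd p)"
definition cinner_prod :: "'a \<times> 'b \<Rightarrow> 'a \<times> 'b \<Rightarrow> complex"
  where "cinner_prod p q = cinner (fst p) (fst q) + cinner (snd p) (snd q)"
instance
proof
  show "cinner q p = cnj (cinner p q)" for p q :: "'a \<times> 'b"
    unfolding cinner_prod_def
    using cinner_commute[of "fst q" "fst p"] cinner_commute[of "snd q" "snd p"] by simp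
qed (auto simp: scaleC_prod_def cinner_prod_def scaleC_add_right scaleC_add_left scaleC_scaleC
      scaleC_of_real cinner_add_left cinner_scaleC_left inner_prod_def inner_eq_Re_cinner
      algebra_simps scaleR_prod_def)
end

instance prod :: (chilbert_space, chilbert_space) chilbert_space ..

definition bounded_clinear :: "('a::complex_inner \<Rightarrow> 'b::complex_inner) \<Rightarrow> bool" where
  "bounded_clinear f \<longleftrightarrow> bounded_linear f \<and> (\<forall>c x. f (c *\<^sub>C x) = c *\<^sub>C f x)"

definition clinear_on :: "'a::complex_inner set \<Rightarrow> ('a \<Rightarrow> 'b::complex_inner) \<Rightarrow> bool" where
  "clinear_on D f \<longleftrightarrow>
     (\<forall>x\<in>D. \<forall>y\<in>D. f (x + y) = f x + f y) \<and> (\<forall>c. \<forall>x\<in>D. f (c *\<^sub>C x) = c *\<^sub>C f x)"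

text \<open>The adjoint of a bounded, everywhere defined operator.\<close>

definition cadjoint :: "('a::complex_inner \<Rightarrow> 'b::complex_inner) \<Rightarrow> 'b \<Rightarrow> 'a" where
  "cadjoint f y = (THE z. \<forall>x. cinner (f x) y = cinner x z)"

definition orth_proj :: "'a::complex_inner set \<Rightarrow> 'a \<Rightarrow> 'a" where
  "orth_proj M x = (THE p. p \<in> M \<and> (\<forall>m\<in>M. cinner (x - p) m = 0))"


section \<open>Unbounded operators\<close>

text \<open>An operator is identified with its graph, so that \<open>Domain T\<close> is its domain, \<open>T \<subseteq> T'\<close> means
  that \<open>T'\<close> extends \<open>T\<close>, and \<open>T\<close> is a closed operator iff \<open>closed T\<close> in the product topology.
  The norm of a pair in the graph is the graph norm.\<close>

definition linear_operator :: "('a::complex_inner \<times> 'b::complex_inner) set \<Rightarrow> bool" where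
  "linear_operator T \<longleftrightarrow> csubspace T \<and> single_valued T"

definition op_app :: "('a \<times> 'b) set \<Rightarrow> 'a \<Rightarrow> 'b" where
  "op_app T u = (THE w. (u, w) \<in> T)"

definition densely_defined :: "('a::complex_inner \<times> 'b::complex_inner) set \<Rightarrow> bool" where
  "densely_defined T \<longleftrightarrow> closure (Domain T) = UNIV"

definition op_adjoint :: "('a::complex_inner \<times> 'b::complex_inner) set \<Rightarrow> ('b \<times> 'a) set" where
  "op_adjoint T = {(v, w). \<forall>(u, u') \<in> T. cinner u' v = cinner u w}"

text \<open>The restriction of \<open>T\<close> to the kernel of \<open>G\<close>, where \<open>G\<close> is defined on \<open>Domain T\<close>.\<close>

definition restrict_ker :: "('a \<times> 'b) set \<Rightarrow> ('a \<Rightarrow> 'c::zero) \<Rightarrow> ('a \<times> 'b) set" where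
  "restrict_ker T G = {(u, w) \<in> T. G u = 0}"

definition eigenspace :: "('a::complex_inner \<times> 'a) set \<Rightarrow> complex \<Rightarrow> 'a set" where
  "eigenspace T z = {u \<in> Domain T. op_app T u - z *\<^sub>C u = 0}"

definition resolvent :: "('a::complex_inner \<times> 'a) set \<Rightarrow> complex \<Rightarrow> 'a \<Rightarrow> 'a" where
  "resolvent T z = inv_into (Domain T) (\<lambda>u. op_app T u - z *\<^sub>C u)"

definition resolvent_set :: "('a::complex_inner \<times> 'a) set \<Rightarrow> complex set" where
  "resolvent_set T =
     {z. bij_betw (\<lambda>u. op_app T u - z *\<^sub>C u) (Domain T) UNIV \<and> bounded_clinear (resolvent T z)}"

definition op_spectrum :: "('a::complex_inner \<times> 'a) set \<Rightarrow> complex set" where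
  "op_spectrum T = - resolvent_set T"


section \<open>Analytic operator-valued functions\<close>

text \<open>Complex differentiability with respect to the operator norm.\<close>

definition op_analytic_on ::
  "(complex \<Rightarrow> 'a::complex_inner \<Rightarrow> 'b::complex_inner) \<Rightarrow> complex set \<Rightarrow> bool" where
  "op_analytic_on F U \<longleftrightarrow> open U \<and> (\<forall>z\<in>U. bounded_clinear (F z) \<and>
     (\<exists>D. bounded_clinear D \<and>
        ((\<lambda>w. onorm (\<lambda>x. inverse (w - z) *\<^sub>C (F w x - F z x) - D x)) \<longlongrightarrow> 0) (at z)))"

text \<open>The function elements \<open>(ball c r, G)\<close> obtained from the function \<open>M\<close> on the open set \<open>R\<close> by
  analytic continuation along finite chains of discs.  The set \<open>R\<close> need not be connected, so
  continuations of \<open>M\<close> that start in one component of \<open>R\<close> may enter another component and differ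
  from \<open>M\<close> there.\<close>

inductive continuation_element ::
  "(complex \<Rightarrow> 'a::complex_inner \<Rightarrow> 'b::complex_inner) \<Rightarrow> complex set \<Rightarrow>
   complex \<Rightarrow> real \<Rightarrow> (complex \<Rightarrow> 'a \<Rightarrow> 'b) \<Rightarrow> bool"
  for M R where
  start: "0 < r \<Longrightarrow> ball c r \<subseteq> R \<Longrightarrow> continuation_element M R c r M"
| step: "continuation_element M R c r G \<Longrightarrow> 0 < s \<Longrightarrow> op_analytic_on H (ball d s) \<Longrightarrow>
     ball c r \<inter> ball d s \<noteq> {} \<Longrightarrow> (\<And>z. z \<in> ball c r \<inter> ball d s \<Longrightarrow> H z = G z) \<Longrightarrow>
     continuation_element M R d s H"

text \<open>Near \<open>z0\<close> the function \<open>M\<close> is given by a single analytic function \<open>F\<close>, and every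
  analytic continuation of \<open>M\<close> to a neighbourhood of \<open>z0\<close> coincides with \<open>F\<close> near \<open>z0\<close>.\<close>

definition point_of_analyticity ::
  "(complex \<Rightarrow> 'a::complex_inner \<Rightarrow> 'b::complex_inner) \<Rightarrow> complex set \<Rightarrow> complex \<Rightarrow> bool" where
  "point_of_analyticity M R z0 \<longleftrightarrow>
     (\<exists>U F. z0 \<in> U \<and> op_analytic_on F U \<and> (\<forall>z \<in> U \<inter> R. F z = M z) \<and>
        (\<forall>d s H. continuation_element M R d s H \<and> z0 \<in> ball d s \<longrightarrow>
           (\<forall>\<^sub>F z in nhds z0. H z = F z)))"

text \<open>\<open>M\<close>, given on the set \<open>R\<close>, extends analytically to a neighbourhood of \<open>z0\<close>.\<close>

definition extends_analytically_at ::
  "(complex \<Rightarrow> 'a::complex_inner \<Rightarrow> 'b::complex_inner) \<Rightarrow> complex set \<Rightarrow> complex \<Rightarrow> bool" where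
  "extends_analytically_at M R z0 \<longleftrightarrow>
     (\<exists>U F. z0 \<in> U \<and> op_analytic_on F U \<and> (\<forall>z \<in> U \<inter> R. F z = M z))"


section \<open>Boundary triplets\<close>

definition adjoint_pair :: "('a::complex_inner \<times> 'a) set \<Rightarrow> ('a \<times> 'a) set \<Rightarrow> bool" where
  "adjoint_pair A At \<longleftrightarrow>
     linear_operator A \<and> closed A \<and> densely_defined A \<and>
     linear_operator At \<and> closed At \<and> densely_defined At \<and>
     At \<subseteq> op_adjoint A \<and> A \<subseteq> op_adjoint At"

text \<open>An operator defined on \<open>Domain T\<close> that is bounded with respect to the graph norm of \<open>T\<close>.
  Its values outside \<open>Domain T\<close> are irrelevant.\<close>

definition graph_bounded_operator ::
  "('a::complex_inner \<times> 'a) set \<Rightarrow> ('a \<Rightarrow> 'b::complex_inner) \<Rightarrow> bool" where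
  "graph_bounded_operator T G \<longleftrightarrow>
     clinear_on (Domain T) G \<and> (\<exists>C. \<forall>(u, w) \<in> T. norm (G u) \<le> C * norm (u, w))"

definition boundary_triplet ::
  "('a::chilbert_space \<times> 'a) set \<Rightarrow> ('a \<times> 'a) set \<Rightarrow>
   ('a \<Rightarrow> 'h::chilbert_space) \<Rightarrow> ('a \<Rightarrow> 'k::chilbert_space) \<Rightarrow> ('a \<Rightarrow> 'k) \<Rightarrow> ('a \<Rightarrow> 'h) \<Rightarrow> bool" where
  "boundary_triplet A At \<Gamma>1 \<Gamma>2 \<Gamma>t1 \<Gamma>t2 \<longleftrightarrow>
     graph_bounded_operator (op_adjoint At) \<Gamma>1 \<and> graph_bounded_operator (op_adjoint At) \<Gamma>2 \<and>
     graph_bounded_operator (op_adjoint A) \<Gamma>t1 \<and> graph_bounded_operator (op_adjoint A) \<Gamma>t2 \<and>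
     (\<lambda>u. (\<Gamma>1 u, \<Gamma>2 u)) ` Domain (op_adjoint At) = UNIV \<and>
     (\<lambda>v. (\<Gamma>t1 v, \<Gamma>t2 v)) ` Domain (op_adjoint A) = UNIV \<and>
     Domain A = {u \<in> Domain (op_adjoint At). \<Gamma>1 u = 0 \<and> \<Gamma>2 u = 0} \<and>
     Domain At = {v \<in> Domain (op_adjoint A). \<Gamma>t1 v = 0 \<and> \<Gamma>t2 v = 0} \<and>
     (\<forall>u \<in> Domain (op_adjoint At). \<forall>v \<in> Domain (op_adjoint A).
        cinner (op_app (op_adjoint At) u) v - cinner u (op_app (op_adjoint A) v) =
        cinner (\<Gamma>1 u) (\<Gamma>t2 v) - cinner (\<Gamma>2 u) (\<Gamma>t1 v))"

text \<open>The inverse of \<open>G\<close> restricted to \<open>eigenspace T \<mu>\<close>; as an operator it is defined on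
  \<open>G ` eigenspace T \<mu>\<close>, whence the form of its range.\<close>

definition solution_operator ::
  "('a::complex_inner \<times> 'a) set \<Rightarrow> ('a \<Rightarrow> 'b) \<Rightarrow> complex \<Rightarrow> 'b \<Rightarrow> 'a" where
  "solution_operator T G \<mu> = inv_into (eigenspace T \<mu>) G"

definition solution_range ::
  "('a::complex_inner \<times> 'a) set \<Rightarrow> ('a \<Rightarrow> 'b) \<Rightarrow> complex \<Rightarrow> 'a set" where
  "solution_range T G \<mu> = solution_operator T G \<mu> ` (G ` eigenspace T \<mu>)"

text \<open>The operator mapping \<open>G u\<close> to \<open>\<Gamma> u\<close> for all \<open>u \<in> eigenspace T z\<close>.  In the application
  \<open>G = \<Gamma>1 - B \<Gamma>2\<close>, its domain \<open>Ran (\<Gamma>1 - B \<Gamma>2)\<close> is the whole space because the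
  pair \<open>(\<Gamma>1, \<Gamma>2)\<close> is surjective.\<close>

definition M_function ::
  "('a::complex_inner \<times> 'a) set \<Rightarrow> ('a \<Rightarrow> 'h) \<Rightarrow> ('a \<Rightarrow> 'k) \<Rightarrow> complex \<Rightarrow> 'h \<Rightarrow> 'k" where
  "M_function T G \<Gamma> z f = (THE g. \<exists>u \<in> eigenspace T z. G u = f \<and> \<Gamma> u = g)"

end

theory Submission
  imports Defs "HOL-Complex_Analysis.Conformal_Mappings"
begin

text \<open>Let \<open>x \<in> ker (At\<^sup>* - \<mu>)\<close> and \<open>y \<in> ker (A\<^sup>* - \<nu>)\<close>.  Green's formula for \<open>y\<close> and the solution
  \<open>x + (z - \<mu>) (A\<^sub>B - z)\<^sup>-\<^sup>1 x\<close> of \<open>(At\<^sup>* - z) u = 0\<close> expresses \<open>cinner ((A\<^sub>B - z)\<^sup>-\<^sup>1 x) y\<close> rationally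
  through \<open>cinner (M(z) (G x)) (Gt y)\<close>, so that it has a limit at \<open>z0\<close>.  By the resolvent identity
  and its dual version the same holds on generators of \<open>S\<close> and \<open>St\<close>.  The only excluded
  position, \<open>z0\<close> conjugate to a point of the resolvent set of \<open>AtB\<close>, is harmless because the
  resolvent of \<open>AB\<close> is bounded near such a point.  On a circle around \<open>z0\<close> the resolvent is
  bounded, so the maximum principle bounds these scalar functions uniformly by
  \<open>C * norm x * norm y\<close>, which carries over to the closures of \<open>S\<close> and \<open>St\<close>.  Finally,
  uniformly bounded weakly holomorphic families are differentiable in operator norm, since
  Cauchy's estimates make their difference quotients uniformly Lipschitz.\<close>

section \<open>Complex inner products and orthogonal projections\<close>

lemma cinner_zero_left [simp]: "cinner 0 y = 0"
  using cinner_add_left[of 0 0 y] by simp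

lemma cinner_diff_left: "cinner (x - y) z = cinner x z - cinner y z"
  using cinner_add_left[of "x - y" y z] by (simp add: algebra_simps)

lemma cinner_add_right: "cinner x (y + z) = cinner x y + cinner x z"
  by (metis cinner_add_left cinner_commute complex_cnj_add)

lemma cinner_zero_right [simp]: "cinner x 0 = 0"
  using cinner_add_right[of x 0 0] by simp

lemma cinner_diff_right: "cinner x (y - z) = cinner x y - cinner x z"
  using cinner_add_right[of x "y - z" z] by (simp add: algebra_simps)

lemma cinner_scaleC_right: "cinner x (a *\<^sub>C y) = cnj a * cinner x y"
  by (metis cinner_scaleC_left cinner_commute complex_cnj_mult)

lemma cinner_self: "cinner x x = of_real ((norm x)\<^sup>2)"
proof (rule complex_eqI)
  show "Re (cinner x x) = Re (of_real ((norm x)\<^sup>2))"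
    by (simp add: inner_eq_Re_cinner[symmetric] power2_norm_eq_inner)
  have "Im (cinner x x) = - Im (cinner x x)"
    using cinner_commute[of x x] by (metis cnj.simps(2))
  then show "Im (cinner x x) = Im (of_real ((norm x)\<^sup>2))" by simp
qed

lemma norm_scaleC: "norm (a *\<^sub>C x) = cmod a * norm x"
proof -
  have "complex_of_real ((norm (a *\<^sub>C x))\<^sup>2) = (a * cnj a) * cinner x x"
    by (simp add: cinner_self[symmetric] cinner_scaleC_left cinner_scaleC_right del: of_real_power)
  also have "\<dots> = of_real ((cmod a * norm x)\<^sup>2)"
    by (simp only: complex_norm_square[symmetric] cinner_self power_mult_distrib of_real_mult of_real_power)
  finally have "(norm (a *\<^sub>C x))\<^sup>2 = (cmod a * norm x)\<^sup>2"
    using of_real_eq_iff by blast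
  then show ?thesis by simp
qed

text \<open>Multiplying \<open>x\<close> by the phase \<open>a\<close> makes the complex product
  real and nonnegative, which reduces the claim to the real inequality. A vanishing product gives
  \<open>a = 0\<close>, hence only \<open>cmod a \<le> 1\<close>.\<close>

lemma cinner_cauchy_schwarz: "cmod (cinner x y) \<le> norm x * norm y"
proof -
  define a where "a = cnj (sgn (cinner x y))"
  have "cmod a \<le> 1" by (simp add: a_def norm_sgn)
  have "a * cinner x y = of_real (cmod (cinner x y))"
    by (cases "cinner x y = 0")
       (auto simp: a_def sgn_eq complex_norm_square[symmetric] mult.commute power2_eq_square)
  then have "cmod (cinner x y) = Re (cinner (a *\<^sub>C x) y)"
    by (simp add: cinner_scaleC_left)
  also have "\<dots> \<le> norm (a *\<^sub>C x) * norm y"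
    by (metis inner_eq_Re_cinner norm_cauchy_schwarz)
  also have "\<dots> \<le> norm x * norm y"
    using \<open>cmod a \<le> 1\<close> by (simp add: norm_scaleC mult_left_le_one_le mult_right_mono)
  finally show ?thesis .
qed

lemma bounded_bilinear_cinner: "bounded_bilinear cinner"
proof
  show "cinner (r *\<^sub>R x) y = r *\<^sub>R cinner x y" for r and x y :: 'a
    by (metis cinner_scaleC_left scaleC_of_real scaleR_conv_of_real)
  show "cinner x (r *\<^sub>R y) = r *\<^sub>R cinner x y" for r and x y :: 'a
    by (metis cinner_scaleC_right complex_cnj_complex_of_real scaleC_of_real scaleR_conv_of_real)
  show "\<exists>K. \<forall>x y :: 'a. norm (cinner x y) \<le> norm x * norm y * K"
    by (rule exI[of _ 1]) (simp add: cinner_cauchy_schwarz)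
qed (auto simp: cinner_add_left cinner_add_right)

lemmas bounded_linear_cinner_left = bounded_bilinear.bounded_linear_left[OF bounded_bilinear_cinner]

lemmas tendsto_cinner_left = bounded_linear.tendsto[OF bounded_linear_cinner_left]

lemma bounded_linear_scaleC: "bounded_linear (\<lambda>x. a *\<^sub>C x)"
proof (rule bounded_linear_intro[where K = "cmod a"])
  show "a *\<^sub>C (r *\<^sub>R x) = r *\<^sub>R (a *\<^sub>C x)" for r x
    by (metis complex_vector.scale_left_commute scaleC_of_real)
qed (auto simp: scaleC_add_right norm_scaleC)

text \<open>Testing with \<open>y = x\<close> suffices. In this way weak estimates that are uniform
  in \<open>y\<close> become norm estimates.\<close>

lemma norm_le_if_cinner_le:
  assumes "0 \<le> K" and "\<And>y. cmod (cinner x y) \<le> K * norm y"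
  shows "norm x \<le> K"
proof (cases "x = 0")
  case False
  have "norm x * norm x \<le> K * norm x"
    using assms(2)[of x] by (simp add: cinner_self power2_eq_square norm_mult)
  then show ?thesis using False by simp
qed (simp add: assms)

lemma cinner_eqI:
  assumes "\<And>x. cinner x y = cinner x z"
  shows "y = z"
proof -
  have "cinner (y - z) (y - z) = 0"
    using assms[of "y - z"] by (simp add: cinner_diff_right)
  then show ?thesis by (simp add: cinner_self)
qed

lemma bounded_clinearD:
  assumes "bounded_clinear f"
  shows "f (x + y) = f x + f y" "f (x - y) = f x - f y" "f (a *\<^sub>C x) = a *\<^sub>C f x"
    "norm (f x) \<le> onorm f * norm x"
  using assms bounded_linear.linear linear_add linear_diff onorm
  unfolding bounded_clinear_def by blast+

lemma bounded_clinearI: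
  assumes "\<And>x y. f (x + y) = f x + f y" "\<And>a x. f (a *\<^sub>C x) = a *\<^sub>C f x"
    "\<And>x. norm (f x) \<le> K * norm x"
  shows "bounded_clinear f"
  unfolding bounded_clinear_def
proof
  show "bounded_linear f"
  proof (rule bounded_linear_intro[where K = K])
    show "f (r *\<^sub>R x) = r *\<^sub>R f x" for r x
      by (metis assms(2) scaleC_of_real)
  qed (auto simp: assms mult.commute)
qed (simp add: assms)

lemma bounded_clinear_pos_bound:
  assumes "bounded_clinear f"
  obtains K where "K > 0" "\<And>x. norm (f x) \<le> K * norm x"
  using assms bounded_linear.pos_bounded[of f]
  unfolding bounded_clinear_def by (metis mult.commute)

lemma bounded_clinear_compose:
  "bounded_clinear f \<Longrightarrow> bounded_clinear g \<Longrightarrow> bounded_clinear (f \<circ> g)"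
  unfolding bounded_clinear_def comp_def by (auto intro: bounded_linear_compose)

section \<open>Closed complex subspaces and orthogonal projections\<close>

lemma csubspace_closure:
  assumes "csubspace M"
  shows "csubspace (closure M)"
  unfolding complex_vector.subspace_def
proof (intro conjI ballI allI)
  show "0 \<in> closure M"
    using assms closure_subset complex_vector.subspace_0 by blast
  show "x + y \<in> closure M" if xy: "x \<in> closure M" "y \<in> closure M" for x y
  proof -
    obtain f g where "\<And>n. f n \<in> M" "f \<longlonglongrightarrow> x" "\<And>n. g n \<in> M" "g \<longlonglongrightarrow> y"
      using xy unfolding closure_sequential by metis
    then have "(\<lambda>n. f n + g n) \<longlonglongrightarrow> x + y" "\<And>n. f n + g n \<in> M"
      using assms by (auto intro: tendsto_add complex_vector.subspace_add)
    then show ?thesis unfolding closure_sequential by (intro exI[of _ "\<lambda>n. f n + g n"]) simp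
  qed
  show "c *\<^sub>C x \<in> closure M" if x: "x \<in> closure M" for c x
  proof -
    obtain f where "\<And>n. f n \<in> M" "f \<longlonglongrightarrow> x"
      using x unfolding closure_sequential by metis
    then have "(\<lambda>n. c *\<^sub>C f n) \<longlonglongrightarrow> c *\<^sub>C x" "\<And>n. c *\<^sub>C f n \<in> M"
      using assms by (auto intro: bounded_linear.tendsto[OF bounded_linear_scaleC]
          complex_vector.subspace_scale)
    then show ?thesis unfolding closure_sequential by (intro exI[of _ "\<lambda>n. c *\<^sub>C f n"]) simp
  qed
qed

text \<open>By the parallelogram law a minimizing sequence is Cauchy: midpoints stay in the convex
  set, so they are no nearer to \<open>x\<close> than the infimum.\<close>

lemma exists_nearest_point:
  fixes M :: "'a::{real_inner, complete_space} set"
  assumes "convex M" "closed M" "M \<noteq> {}"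
  shows "\<exists>p\<in>M. \<forall>m\<in>M. norm (x - p) \<le> norm (x - m)"
proof -
  define d where "d = (INF m\<in>M. (norm (x - m))\<^sup>2)"
  have bdd: "bdd_below ((\<lambda>m. (norm (x - m))\<^sup>2) ` M)"
    by (rule bdd_belowI[of _ 0]) auto
  have d_le: "d \<le> (norm (x - m))\<^sup>2" if "m \<in> M" for m
    unfolding d_def by (rule cINF_lower[OF bdd that])
  have "\<exists>m\<in>M. (norm (x - m))\<^sup>2 < d + 1 / (real n + 1)" for n
    using cInf_lessD[of "(\<lambda>m. (norm (x - m))\<^sup>2) ` M" "d + 1 / (real n + 1)"] assms(3)
    unfolding d_def by auto
  then obtain m where mM: "\<And>n. m n \<in> M"
    and m_lt: "\<And>n. (norm (x - m n))\<^sup>2 < d + 1 / (real n + 1)"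
    by metis
  have close: "(dist (m i) (m j))\<^sup>2 \<le> 2 / (real i + 1) + 2 / (real j + 1)" for i j
  proof -
    have "(1/2) *\<^sub>R m i + (1/2) *\<^sub>R m j \<in> M"
      using convexD[OF assms(1) mM[of i] mM[of j], of "1/2" "1/2"] by simp
    then have "d \<le> (norm (x - ((1/2) *\<^sub>R m i + (1/2) *\<^sub>R m j)))\<^sup>2"
      by (rule d_le)
    moreover have "x - ((1/2) *\<^sub>R m i + (1/2) *\<^sub>R m j) = (1/2) *\<^sub>R ((x - m i) + (x - m j))"
      by (simp add: algebra_simps flip: scaleR_left.add)
    moreover have "(norm ((x - m i) + (x - m j)))\<^sup>2 + (norm ((x - m i) - (x - m j)))\<^sup>2
        = 2 * (norm (x - m i))\<^sup>2 + 2 * (norm (x - m j))\<^sup>2"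
      by (simp only: power2_norm_eq_inner inner_add_left inner_add_right inner_diff_left inner_diff_right)
        simp
    moreover have "norm ((x - m i) - (x - m j)) = dist (m i) (m j)"
      by (simp add: dist_norm norm_minus_commute)
    ultimately show ?thesis
      using m_lt[of i] m_lt[of j] by (simp add: power_mult_distrib power_divide)
  qed
  have "Cauchy m"
  proof (rule metric_CauchyI)
    fix e :: real
    assume "0 < e"
    then obtain N where "inverse (of_nat (Suc N)) < e\<^sup>2 / 4"
      using reals_Archimedean[of "e\<^sup>2 / 4"] by auto
    then have N: "4 / (real N + 1) < e\<^sup>2"
      by (simp add: field_simps)
    have "dist (m i) (m j) < e" if "i \<ge> N" "j \<ge> N" for i j
    proof -
      have "2 / (real i + 1) \<le> 2 / (real N + 1)" "2 / (real j + 1) \<le> 2 / (real N + 1)"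
        by (rule frac_le; use that in simp)+
      then have "(dist (m i) (m j))\<^sup>2 < e\<^sup>2"
        using close[of i j] N by simp
      then show ?thesis
        using \<open>0 < e\<close> power_less_imp_less_base[of "dist (m i) (m j)" 2 e] by simp
    qed
    then show "\<exists>N. \<forall>i\<ge>N. \<forall>j\<ge>N. dist (m i) (m j) < e" by blast
  qed
  then obtain p where p: "m \<longlonglongrightarrow> p"
    using Cauchy_convergent convergent_def by blast
  have "p \<in> M"
    using closed_sequentially[OF assms(2) _ p] mM by blast
  have "(norm (x - p))\<^sup>2 \<le> d"
  proof (rule LIMSEQ_le)
    show "(\<lambda>n. (norm (x - m n))\<^sup>2) \<longlonglongrightarrow> (norm (x - p))\<^sup>2"
      by (intro tendsto_intros p)
    show "(\<lambda>n. d + 1 / (real n + 1)) \<longlonglongrightarrow> d"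
      using tendsto_add[OF tendsto_const[of d] LIMSEQ_inverse_real_of_nat]
      by (simp add: inverse_eq_divide add.commute)
  qed (use m_lt less_imp_le in blast)
  then have "norm (x - p) \<le> norm (x - m)" if "m \<in> M" for m
    using d_le[OF that] by (meson norm_ge_zero order_trans power2_le_imp_le)
  then show ?thesis using \<open>p \<in> M\<close> by blast
qed

lemma exists_orthogonal_projection:
  fixes M :: "'a::chilbert_space set"
  assumes "csubspace M" "closed M"
  shows "\<exists>p\<in>M. \<forall>m\<in>M. cinner (x - p) m = 0"
proof -
  have scaleR: "r *\<^sub>R m \<in> M" if "m \<in> M" for r m
    by (metis assms(1) complex_vector.subspace_scale scaleC_of_real that)
  have "convex M"
    unfolding convex_def using scaleR assms(1) by (blast intro: complex_vector.subspace_add)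
  moreover have "M \<noteq> {}"
    using assms(1) complex_vector.subspace_0 by blast
  ultimately obtain p where "p \<in> M" and p: "\<And>m. m \<in> M \<Longrightarrow> norm (x - p) \<le> norm (x - m)"
    using exists_nearest_point assms(2) by blast
  have Re0: "Re (cinner (x - p) m) = 0" if "m \<in> M" for m
  proof (rule ccontr)
    \<comment> \<open>This \<open>t\<close> minimizes the norm of
      \<open>(x - p) - t *\<^sub>R m\<close> over the reals. A nonzero inner product would make that
      minimum smaller than the value at 0, against the choice of \<open>p\<close>.\<close>
    define t where "t = inner (x - p) m / (norm m)\<^sup>2"
    assume "Re (cinner (x - p) m) \<noteq> 0"
    then have nz: "inner (x - p) m \<noteq> 0" by (simp add: inner_eq_Re_cinner)
    then have "norm m \<noteq> 0" by auto
    have "p + t *\<^sub>R m \<in> M"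
      using assms(1) \<open>p \<in> M\<close> scaleR[OF that] by (rule complex_vector.subspace_add)
    then have "(norm (x - p))\<^sup>2 \<le> (norm ((x - p) - t *\<^sub>R m))\<^sup>2"
      using p[of "p + t *\<^sub>R m"] by (simp add: diff_diff_eq)
    also have "\<dots> = (norm (x - p))\<^sup>2 - 2 * t * inner (x - p) m + t\<^sup>2 * (norm m)\<^sup>2"
      unfolding power2_norm_eq_inner
      by (simp add: inner_diff_left inner_diff_right inner_commute power2_eq_square)
    also have "\<dots> = (norm (x - p))\<^sup>2 - (inner (x - p) m)\<^sup>2 / (norm m)\<^sup>2"
      using \<open>norm m \<noteq> 0\<close> by (simp add: t_def power2_eq_square divide_simps)
    finally have "(inner (x - p) m)\<^sup>2 / (norm m)\<^sup>2 \<le> 0" by simp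
    moreover have "(inner (x - p) m)\<^sup>2 / (norm m)\<^sup>2 > 0"
      using nz \<open>norm m \<noteq> 0\<close> by simp
    ultimately show False by simp
  qed
  have "cinner (x - p) m = 0" if "m \<in> M" for m
  proof (rule complex_eqI)
    \<comment> \<open>The real part of the product with \<open>\<i> *\<^sub>C m\<close> is the
      imaginary part of the product with \<open>m\<close>.\<close>
    have "\<i> *\<^sub>C m \<in> M"
      using assms(1) that by (rule complex_vector.subspace_scale)
    from Re0[OF this] show "Im (cinner (x - p) m) = Im 0"
      by (simp add: cinner_scaleC_right)
  qed (simp add: Re0 that)
  then show ?thesis using \<open>p \<in> M\<close> by blast
qed

lemma orth_proj_unique:
  assumes "csubspace M" "p \<in> M" "q \<in> M"
    "\<And>m. m \<in> M \<Longrightarrow> cinner (x - p) m = 0" "\<And>m. m \<in> M \<Longrightarrow> cinner (x - q) m = 0"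
  shows "p = q"
proof -
  have "p - q \<in> M" using assms(1-3) by (rule complex_vector.subspace_diff)
  then have "cinner (x - q) (p - q) - cinner (x - p) (p - q) = 0"
    using assms(4,5) by simp
  then have "cinner (p - q) (p - q) = 0"
    by (simp add: cinner_diff_left)
  then show ?thesis by (simp add: cinner_self)
qed

lemma orth_proj_props:
  fixes M :: "'a::chilbert_space set"
  assumes "csubspace M" "closed M"
  shows "orth_proj M x \<in> M" "m \<in> M \<Longrightarrow> cinner (x - orth_proj M x) m = 0"
proof -
  have "\<exists>!p. p \<in> M \<and> (\<forall>m\<in>M. cinner (x - p) m = 0)"
    using exists_orthogonal_projection[OF assms] orth_proj_unique[OF assms(1)] by metis
  from theI'[OF this] show "orth_proj M x \<in> M" "m \<in> M \<Longrightarrow> cinner (x - orth_proj M x) m = 0"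
    unfolding orth_proj_def by blast+
qed

lemma orth_proj_eqI:
  fixes M :: "'a::chilbert_space set"
  assumes "csubspace M" "closed M" "p \<in> M" "\<And>m. m \<in> M \<Longrightarrow> cinner (x - p) m = 0"
  shows "orth_proj M x = p"
  using orth_proj_unique[OF assms(1)] orth_proj_props[OF assms(1,2)] assms(3,4) by metis

lemma cinner_orth_proj:
  fixes M :: "'a::chilbert_space set"
  assumes "csubspace M" "closed M"
  shows "cinner (orth_proj M x) y = cinner x (orth_proj M y)"
proof -
  have "cinner (orth_proj M x) (y - orth_proj M y) = cnj 0"
    using orth_proj_props(2)[OF assms orth_proj_props(1)[OF assms, of x], of y] cinner_commute
    by metis
  then have "cinner (orth_proj M x) y = cinner (orth_proj M x) (orth_proj M y)"
    by (simp add: cinner_diff_right)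
  also have "\<dots> = cinner x (orth_proj M y)"
    using orth_proj_props(2)[OF assms orth_proj_props(1)[OF assms, of y], of x]
    by (simp add: cinner_diff_left)
  finally show ?thesis .
qed

lemma norm_orth_proj_le:
  fixes M :: "'a::chilbert_space set"
  assumes "csubspace M" "closed M"
  shows "norm (orth_proj M x) \<le> norm x"
proof -
  let ?p = "orth_proj M x"
  have "cinner ?p ?p = cinner x ?p"
    using orth_proj_props(2)[OF assms orth_proj_props(1)[OF assms, of x], of x]
    by (simp add: cinner_diff_left)
  then have "(norm ?p)\<^sup>2 = cmod (cinner x ?p)"
    by (metis cinner_self norm_of_real abs_of_nonneg zero_le_power2)
  then have "norm ?p * norm ?p \<le> norm x * norm ?p"
    using cinner_cauchy_schwarz[of x ?p] by (simp add: power2_eq_square)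
  then show ?thesis by (cases "norm ?p = 0") auto
qed

lemma bounded_clinear_orth_proj:
  fixes M :: "'a::chilbert_space set"
  assumes "csubspace M" "closed M"
  shows "bounded_clinear (orth_proj M)"
proof (rule bounded_clinearI[where K = 1])
  note P = orth_proj_props[OF assms]
  show "orth_proj M (x + y) = orth_proj M x + orth_proj M y" for x y
  proof (rule orth_proj_eqI[OF assms])
    show "orth_proj M x + orth_proj M y \<in> M"
      using assms(1) P(1) by (blast intro: complex_vector.subspace_add)
    show "cinner (x + y - (orth_proj M x + orth_proj M y)) m = 0" if "m \<in> M" for m
      using P(2)[OF that, of x] P(2)[OF that, of y]
      by (simp add: cinner_diff_left cinner_add_left)
  qed
  show "orth_proj M (a *\<^sub>C x) = a *\<^sub>C orth_proj M x" for a x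
  proof (rule orth_proj_eqI[OF assms])
    show "a *\<^sub>C orth_proj M x \<in> M"
      using assms(1) P(1) by (blast intro: complex_vector.subspace_scale)
    show "cinner (a *\<^sub>C x - a *\<^sub>C orth_proj M x) m = 0" if "m \<in> M" for m
      using P(2)[OF that, of x]
      by (simp add: cinner_diff_left cinner_scaleC_left flip: right_diff_distrib)
  qed
qed (simp add: norm_orth_proj_le[OF assms])

section \<open>Riesz representation and bounded adjoints\<close>

lemma exists_riesz_vector:
  fixes f :: "'a::chilbert_space \<Rightarrow> complex"
  assumes "bounded_clinear f"
  shows "\<exists>z. \<forall>x. f x = cinner x z"
proof (cases "\<forall>x. f x = 0")
  case True
  then show ?thesis by (intro exI[of _ 0]) simp
next
  case False
  then obtain x0 where x0: "f x0 \<noteq> 0" by blast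
  note f = bounded_clinearD[OF assms]
  define N where "N = {x. f x = 0}"
  have N: "csubspace N"
    using f(2)[of 0 0] by (auto simp: N_def complex_vector.subspace_def f scaleC_complex_def)
  have "closed N"
    unfolding N_def using assms
    by (intro closed_Collect_eq)
      (auto simp: bounded_clinear_def intro: linear_continuous_on)
  \<comment> \<open>The component of \<open>x0\<close> orthogonal to the kernel of \<open>f\<close>.
    It carries the whole value \<open>f x0\<close>, so every vector is a multiple of
    \<open>e\<close> plus an element of the kernel.\<close>
  define e where "e = x0 - orth_proj N x0"
  have orth: "cinner e m = 0" if "m \<in> N" for m
    unfolding e_def using orth_proj_props(2)[OF N \<open>closed N\<close> that] .
  have "f e = f x0"
    using orth_proj_props(1)[OF N \<open>closed N\<close>, of x0] by (simp add: e_def f N_def)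
  then have "f e \<noteq> 0" "e \<noteq> 0"
    using x0 f(2)[of 0 0] by auto
  have "f x = cinner x (cnj (f e / cinner e e) *\<^sub>C e)" for x
  proof -
    have "x - (f x / f e) *\<^sub>C e \<in> N"
      using \<open>f e \<noteq> 0\<close> by (simp add: N_def f scaleC_complex_def)
    then have "cinner (x - (f x / f e) *\<^sub>C e) e = 0"
      using orth by (metis cinner_commute complex_cnj_zero)
    then have "cinner x e = f x / f e * cinner e e"
      by (simp add: cinner_diff_left cinner_scaleC_left)
    then show ?thesis
      using \<open>f e \<noteq> 0\<close> \<open>e \<noteq> 0\<close> by (simp add: cinner_scaleC_right cinner_self)
  qed
  then show ?thesis by blast
qed

text \<open>The Riesz vector of \<open>x \<mapsto> cinner (B x) y\<close> exists and is unique, so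
  the definite description in \<open>cadjoint\<close> denotes it.\<close>

lemma cinner_cadjoint:
  fixes B :: "'a::chilbert_space \<Rightarrow> 'b::complex_inner"
  assumes "bounded_clinear B"
  shows "cinner (B x) y = cinner x (cadjoint B y)"
proof -
  have "bounded_clinear (\<lambda>x. cinner (B x) y)"
    using assms bounded_linear_compose[OF bounded_linear_cinner_left[of y]]
    by (auto simp: bounded_clinear_def cinner_scaleC_left scaleC_complex_def)
  then obtain z where "\<forall>x. cinner (B x) y = cinner x z"
    using exists_riesz_vector by blast
  then have "\<exists>!z. \<forall>x. cinner (B x) y = cinner x z"
    using cinner_eqI by metis
  from theI'[OF this] show ?thesis
    unfolding cadjoint_def by blast
qed

section \<open>Analyticity in operator norm from weak holomorphy\<close>

text \<open>Discs of radius \<open>r/2\<close> centred in the half disc stay inside the large one.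
  Cauchy's estimate on them bounds the derivative, and convexity of the half disc turns this into a
  Lipschitz bound.\<close>

lemma holomorphic_bounded_lipschitz:
  assumes "h holomorphic_on ball z0 r" "0 < r" "\<And>z. z \<in> ball z0 r \<Longrightarrow> cmod (h z) \<le> K"
  shows "z \<in> ball z0 (r/2) \<Longrightarrow> cmod (deriv h z) \<le> 2 * K / r"
    and "w \<in> ball z0 (r/2) \<Longrightarrow> z \<in> ball z0 (r/2) \<Longrightarrow>
      cmod (h w - h z) \<le> 2 * K / r * cmod (w - z)"
proof -
  show deriv: "cmod (deriv h z) \<le> 2 * K / r" if "z \<in> ball z0 (r/2)" for z
  proof -
    have sub: "cball z (r/2) \<subseteq> ball z0 r"
    proof
      fix u assume "u \<in> cball z (r/2)"
      then show "u \<in> ball z0 r"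
        using that dist_triangle[of z0 u z] by simp
    qed
    have "cmod ((deriv ^^ 1) h z) \<le> fact 1 * K / (r/2)^1"
    proof (rule Cauchy_inequality)
      show "h holomorphic_on ball z (r/2)"
        using assms(1) sub ball_subset_cball holomorphic_on_subset by blast
      show "continuous_on (cball z (r/2)) h"
        using assms(1) sub holomorphic_on_imp_continuous_on continuous_on_subset by blast
      show "cmod (h x) \<le> K" if "cmod (z - x) = r/2" for x
        using assms(3) sub that by (auto simp: dist_norm)
    qed (use assms(2) in simp)
    then show ?thesis by (simp add: mult.commute)
  qed
  show "cmod (h w - h z) \<le> 2 * K / r * cmod (w - z)"
    if "w \<in> ball z0 (r/2)" "z \<in> ball z0 (r/2)"
  proof (rule field_differentiable_bound[OF convex_ball _ deriv that])
    fix u assume "u \<in> ball z0 (r/2)"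
    then have "u \<in> ball z0 r" using assms(2) by simp
    then show "(h has_field_derivative deriv h u) (at u within ball z0 (r/2))"
      using assms(1) by (blast intro: holomorphic_derivI[OF _ open_ball])
  qed
qed

text \<open>Completed by the derivative at \<open>z\<close>, the quotient is holomorphic on the half
  disc and bounded there by the previous lemma. The same lemma, applied to the quotient, gives the
  estimate on the quarter disc.\<close>

lemma difference_quotient_lipschitz:
  assumes h: "h holomorphic_on ball z0 r" "0 < r" "\<And>z. z \<in> ball z0 r \<Longrightarrow> cmod (h z) \<le> K"
    and z: "z \<in> ball z0 (r/4)" "w \<in> ball z0 (r/4) - {z}" "w' \<in> ball z0 (r/4) - {z}"
  shows "cmod ((h w - h z) / (w - z) - (h w' - h z) / (w' - z)) \<le> 8 * K / r\<^sup>2 * cmod (w - w')"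
proof -
  define g where "g u = (if u = z then deriv h z else (h u - h z) / (u - z))" for u
  have z2: "z \<in> ball z0 (r/2)" using z(1) h(2) by simp
  have "g holomorphic_on ball z0 (r/2)"
    unfolding g_def
  proof (rule pole_lemma)
    show "h holomorphic_on ball z0 (r/2)"
      using h(1) by (rule holomorphic_on_subset) (rule subset_ball, use h(2) in simp)
  qed (use z2 in simp)
  moreover have "cmod (g u) \<le> 2 * K / r" if "u \<in> ball z0 (r/2)" for u
    using holomorphic_bounded_lipschitz[OF h, of z] holomorphic_bounded_lipschitz(2)[OF h that z2] z2
    by (auto simp: g_def norm_divide divide_le_eq)
  \<comment> \<open>Radius \<open>r/2\<close> and bound \<open>2 * K / r\<close> are inserted; the
    constant simplifies to \<open>8 * K / r\<^sup>2\<close>.\<close>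
  ultimately have "cmod (g w - g w') \<le> 2 * (2 * K / r) / (r/2) * cmod (w - w')"
    using holomorphic_bounded_lipschitz(2)[of g z0 "r/2" "2 * K / r" w w'] h(2) z by simp
  then show ?thesis
    using z h(2) by (simp add: g_def power2_eq_square)
qed

lemma eventually_at_punctured:
  assumes "open V" "z \<in> V"
  shows "\<forall>\<^sub>F w in at z. w \<in> V - {z}"
  unfolding eventually_at_topological using assms by auto

lemma punctured_ball_subset:
  assumes "\<forall>\<^sub>F z in at z0. z \<in> V"
  obtains r where "0 < r" "ball z0 r - {z0} \<subseteq> V"
proof -
  obtain r where "0 < r" "\<forall>z. z \<noteq> z0 \<and> dist z z0 < r \<longrightarrow> z \<in> V"
    using assms unfolding eventually_at by blast
  then show thesis by (intro that[of r]) (auto simp: dist_commute)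
qed

text \<open>Lipschitz dependence on the parameter and completeness produce the limit at the omitted
  point, with an error linear in \<open>norm x\<close>. It is applied to difference quotients, where
  the limit is the derivative, and to a family with a removable singularity, where it is the missing
  value.\<close>

lemma lipschitz_family_limit:
  fixes q :: "complex \<Rightarrow> 'a::complex_inner \<Rightarrow> 'b::chilbert_space"
  assumes V: "open V" "z \<in> V" and "0 \<le> L"
    and q: "\<And>w. w \<in> V - {z} \<Longrightarrow> bounded_clinear (q w)"
    and lip: "\<And>w w' x. w \<in> V - {z} \<Longrightarrow> w' \<in> V - {z} \<Longrightarrow>
      norm (q w x - q w' x) \<le> L * norm x * cmod (w - w')"
  shows "\<exists>D. bounded_clinear D \<and>
    (\<forall>w\<in>V - {z}. \<forall>x. norm (q w x - D x) \<le> L * norm x * cmod (w - z)) \<and>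
    (\<forall>x. ((\<lambda>w. q w x) \<longlongrightarrow> D x) (at z))"
proof -
  have evV: "\<forall>\<^sub>F w in at z. w \<in> V - {z}"
    using V by (rule eventually_at_punctured)
  \<comment> \<open>An open set of the plane has no isolated points, so the Lipschitz extension to
    the closure has a value at \<open>z\<close>.\<close>
  have cl: "z \<in> closure (V - {z})"
    using at_within_eq_bot_iff[of z V] at_within_open[OF V(2,1)] by (simp add: at_neq_bot)
  have "\<exists>l. \<forall>w\<in>V - {z}. norm (q w x - l) \<le> L * norm x * cmod (w - z)" for x
  proof -
    have "(L * norm x)-lipschitz_on (V - {z}) (\<lambda>w. q w x)"
      using lip \<open>0 \<le> L\<close> by (auto simp: lipschitz_on_def dist_norm)
    then obtain g where g: "(L * norm x)-lipschitz_on (closure (V - {z})) g"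
      "\<And>w. w \<in> V - {z} \<Longrightarrow> g w = q w x"
      using lipschitz_extend_closure by blast
    have "norm (q w x - g z) \<le> L * norm x * cmod (w - z)" if "w \<in> V - {z}" for w
      using lipschitz_onD[OF g(1) _ cl, of w] that g(2)[OF that] closure_subset[of "V - {z}"]
      by (auto simp: dist_norm)
    then show ?thesis by blast
  qed
  then obtain D where D: "\<And>w x. w \<in> V - {z} \<Longrightarrow> norm (q w x - D x) \<le> L * norm x * cmod (w - z)"
    by metis
  have lim: "((\<lambda>w. q w x) \<longlongrightarrow> D x) (at z)" for x
  proof (rule LIM_zero_cancel, rule Lim_null_comparison)
    show "\<forall>\<^sub>F w in at z. norm (q w x - D x) \<le> L * norm x * cmod (w - z)"
      using evV by eventually_elim (rule D)
    have "((\<lambda>w. L * norm x * cmod (w - z)) \<longlongrightarrow> L * norm x * cmod (z - z)) (at z)"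
      by (intro tendsto_intros)
    then show "((\<lambda>w. L * norm x * cmod (w - z)) \<longlongrightarrow> 0) (at z)" by simp
  qed
  obtain w where w: "w \<in> V - {z}"
    using cl by (metis closure_empty empty_iff ex_in_conv)
  \<comment> \<open>Linearity passes to the pointwise limit. Boundedness comes from comparing
    \<open>D\<close> with the single operator \<open>q w\<close>.\<close>
  have "bounded_clinear D"
  proof (rule bounded_clinearI[where K = "onorm (q w) + L * cmod (w - z)"])
    show "D (x + y) = D x + D y" for x y
    proof (rule tendsto_unique[OF _ lim])
      show "((\<lambda>w. q w (x + y)) \<longlongrightarrow> D x + D y) (at z)"
        by (rule Lim_transform_eventually[OF tendsto_add[OF lim lim]])
          (use evV in eventually_elim, simp add: bounded_clinearD[OF q])
    qed simp
    show "D (a *\<^sub>C x) = a *\<^sub>C D x" for a x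
    proof (rule tendsto_unique[OF _ lim])
      show "((\<lambda>w. q w (a *\<^sub>C x)) \<longlongrightarrow> a *\<^sub>C D x) (at z)"
        by (rule Lim_transform_eventually[OF bounded_linear.tendsto[OF bounded_linear_scaleC lim]])
          (use evV in eventually_elim, simp add: bounded_clinearD[OF q])
    qed simp
    show "norm (D x) \<le> (onorm (q w) + L * cmod (w - z)) * norm x" for x
      using D[OF w, of x] bounded_clinearD(4)[OF q[OF w], of x] norm_triangle_sub[of "D x" "q w x"]
      by (simp add: algebra_simps norm_minus_commute)
  qed
  then show ?thesis using D lim by blast
qed

text \<open>The scalar Lipschitz constants of the difference quotients are proportional to
  \<open>norm x * norm y\<close>. Uniformity in \<open>y\<close> gives norm convergence for each
  \<open>x\<close>, and uniformity in \<open>x\<close> gives convergence in operator norm. The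
  quarter radius is that of \<open>difference_quotient_lipschitz\<close>.\<close>

lemma op_analytic_on_if_weakly_holomorphic:
  fixes F :: "complex \<Rightarrow> 'a::complex_inner \<Rightarrow> 'b::chilbert_space"
  assumes "0 < r" "0 \<le> C"
    and F: "\<And>z. z \<in> ball z0 r \<Longrightarrow> bounded_clinear (F z)"
    and hol: "\<And>x y. (\<lambda>z. cinner (F z x) y) holomorphic_on ball z0 r"
    and bound: "\<And>z x y. z \<in> ball z0 r \<Longrightarrow> cmod (cinner (F z x) y) \<le> C * norm x * norm y"
  shows "op_analytic_on F (ball z0 (r/4))"
  unfolding op_analytic_on_def
proof (intro conjI ballI)
  fix z assume z: "z \<in> ball z0 (r/4)"
  define L where "L = 8 * C / r\<^sup>2"
  define q where "q w x = inverse (w - z) *\<^sub>C (F w x - F z x)" for w x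
  have sub: "u \<in> ball z0 r" if "u \<in> ball z0 (r/4)" for u
    using that \<open>0 < r\<close> by simp
  show "bounded_clinear (F z)" using F sub z by blast
  have q: "bounded_clinear (q w)" if "w \<in> ball z0 (r/4) - {z}" for w
  proof (rule bounded_clinearI[where K = "cmod (inverse (w - z)) * (onorm (F w) + onorm (F z))"])
    have w: "bounded_clinear (F w)" and z: "bounded_clinear (F z)"
      using F sub z that by auto
    show "q w (x + y) = q w x + q w y" for x y
      by (simp add: q_def bounded_clinearD[OF w] bounded_clinearD[OF z] flip: scaleC_add_right)
    show "q w (a *\<^sub>C x) = a *\<^sub>C q w x" for a x
      by (simp add: q_def bounded_clinearD[OF w] bounded_clinearD[OF z] scaleC_scaleC mult.commute
          flip: complex_vector.scale_right_diff_distrib)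
    have "norm (F w x - F z x) \<le> (onorm (F w) + onorm (F z)) * norm x" for x
      using norm_triangle_ineq4[of "F w x" "F z x"] bounded_clinearD(4)[OF w, of x]
        bounded_clinearD(4)[OF z, of x] by (simp add: algebra_simps)
    then show "norm (q w x) \<le> cmod (inverse (w - z)) * (onorm (F w) + onorm (F z)) * norm x" for x
      unfolding q_def norm_scaleC mult.assoc by (rule mult_left_mono) simp
  qed
  have lip: "norm (q w x - q w' x) \<le> L * norm x * cmod (w - w')"
    if w: "w \<in> ball z0 (r/4) - {z}" "w' \<in> ball z0 (r/4) - {z}" for w w' x
  proof (rule norm_le_if_cinner_le)
    show "0 \<le> L * norm x * cmod (w - w')" using \<open>0 \<le> C\<close> by (simp add: L_def)
    fix y
    have "cmod ((cinner (F w x) y - cinner (F z x) y) / (w - z)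
        - (cinner (F w' x) y - cinner (F z x) y) / (w' - z))
        \<le> 8 * (C * norm x * norm y) / r\<^sup>2 * cmod (w - w')"
      by (rule difference_quotient_lipschitz[OF hol \<open>0 < r\<close> bound z w])
    then show "cmod (cinner (q w x - q w' x) y) \<le> L * norm x * cmod (w - w') * norm y"
      by (simp add: q_def L_def cinner_diff_left cinner_scaleC_left divide_inverse mult_ac)
  qed
  have "0 \<le> L" using \<open>0 \<le> C\<close> by (simp add: L_def)
  obtain D where D: "bounded_clinear D"
    "\<And>w x. w \<in> ball z0 (r/4) - {z} \<Longrightarrow> norm (q w x - D x) \<le> L * norm x * cmod (w - z)"
    using lipschitz_family_limit[of "ball z0 (r/4)" z L q] z \<open>0 \<le> L\<close> q lip by auto
  have "((\<lambda>w. onorm (\<lambda>x. q w x - D x)) \<longlongrightarrow> 0) (at z)"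
  proof (rule tendsto_sandwich)
    have ev: "\<forall>\<^sub>F w in at z. w \<in> ball z0 (r/4) - {z}"
      using open_ball z by (rule eventually_at_punctured)
    show "\<forall>\<^sub>F w in at z. 0 \<le> onorm (\<lambda>x. q w x - D x)"
      using ev
    proof eventually_elim
      case (elim w)
      have "bounded_linear (\<lambda>x. q w x - D x)"
        using q[OF elim] D(1) by (auto simp: bounded_clinear_def intro: bounded_linear_sub)
      then show ?case by (rule onorm_pos_le)
    qed
    show "\<forall>\<^sub>F w in at z. onorm (\<lambda>x. q w x - D x) \<le> L * cmod (w - z)"
      using ev
    proof eventually_elim
      case (elim w)
      show ?case
        by (rule onorm_bound) (use D(2)[OF elim] \<open>0 \<le> L\<close> in \<open>simp_all add: mult_ac\<close>)
    qed
    have "((\<lambda>w. L * cmod (w - z)) \<longlongrightarrow> L * cmod (z - z)) (at z)"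
      by (intro tendsto_intros)
    then show "((\<lambda>w. L * cmod (w - z)) \<longlongrightarrow> 0) (at z)" by simp
  qed simp
  then show "\<exists>D. bounded_clinear D \<and>
      ((\<lambda>w. onorm (\<lambda>x. inverse (w - z) *\<^sub>C (F w x - F z x) - D x)) \<longlongrightarrow> 0) (at z)"
    using D(1) unfolding q_def by blast
qed simp

text \<open>The increment is \<open>w - z\<close> times the sum of \<open>D x\<close> and the error
  \<open>e D w x\<close>, and \<open>onorm (e D w)\<close> tends to 0. This turns analyticity of the
  M-function into limits of its matrix elements.\<close>

lemma op_analytic_on_tendsto:
  assumes F: "op_analytic_on F U" and z: "z \<in> U"
  shows "((\<lambda>w. F w x) \<longlongrightarrow> F z x) (at z)"
proof -
  define e where "e D w u = inverse (w - z) *\<^sub>C (F w u - F z u) - D u" for D w u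
  obtain D where D: "bounded_clinear D" and lim: "((\<lambda>w. onorm (e D w)) \<longlongrightarrow> 0) (at z)"
    using F z unfolding op_analytic_on_def e_def by blast
  have Fw: "bounded_linear (F w)" if "w \<in> U" for w
    using F that by (auto simp: op_analytic_on_def bounded_clinear_def)
  have le: "norm (F w x - F z x) \<le> cmod (w - z) * (onorm (e D w) * norm x + norm (D x))"
    if w: "w \<in> U - {z}" for w
  proof -
    have "bounded_linear (e D w)"
      unfolding e_def using Fw[of w] Fw[OF z] w D
      by (intro bounded_linear_sub bounded_linear_compose[OF bounded_linear_scaleC])
        (auto simp: bounded_clinear_def)
    then have "norm (e D w x + D x) \<le> onorm (e D w) * norm x + norm (D x)"
      by (intro norm_triangle_mono onorm order_refl)
    moreover have "F w x - F z x = (w - z) *\<^sub>C (e D w x + D x)"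
      using w by (simp add: e_def scaleC_scaleC)
    ultimately show ?thesis
      by (simp add: norm_scaleC mult_left_mono)
  qed
  have ev: "\<forall>\<^sub>F w in at z.
      norm (F w x - F z x) \<le> cmod (w - z) * (onorm (e D w) * norm x + norm (D x))"
    using eventually_at_punctured[OF _ z] F le
    by (auto simp: op_analytic_on_def elim!: eventually_mono)
  have "((\<lambda>w. cmod (w - z) * (onorm (e D w) * norm x + norm (D x)))
      \<longlongrightarrow> cmod (z - z) * (0 * norm x + norm (D x))) (at z)"
    by (intro tendsto_intros lim)
  then have "((\<lambda>w. cmod (w - z) * (onorm (e D w) * norm x + norm (D x))) \<longlongrightarrow> 0) (at z)"
    by simp
  from LIM_zero_cancel[OF Lim_null_comparison[OF ev this]] show ?thesis .
qed

text \<open>Riemann's theorem extends every matrix element, and the uniform bound ensures that the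
  values at \<open>z0\<close> are the matrix elements of one bounded operator.\<close>

lemma op_analytic_removable_singularity:
  fixes F :: "complex \<Rightarrow> 'a::complex_inner \<Rightarrow> 'b::chilbert_space"
  assumes "0 < r" "0 \<le> C"
    and F: "\<And>z. z \<in> ball z0 r - {z0} \<Longrightarrow> bounded_clinear (F z)"
    and hol: "\<And>x y. (\<lambda>z. cinner (F z x) y) holomorphic_on ball z0 r - {z0}"
    and bound: "\<And>z x y. z \<in> ball z0 r - {z0} \<Longrightarrow> cmod (cinner (F z x) y) \<le> C * norm x * norm y"
  shows "\<exists>F'. op_analytic_on F' (ball z0 (r/4)) \<and> (\<forall>z. z \<noteq> z0 \<longrightarrow> F' z = F z)"
proof -
  have ev: "\<forall>\<^sub>F z in at z0. z \<in> ball z0 r - {z0}"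
    by (rule eventually_at_punctured) (use \<open>0 < r\<close> in auto)
  have "\<exists>h. h holomorphic_on ball z0 r \<and> (\<forall>z\<in>ball z0 r - {z0}. h z = cinner (F z x) y)" for x y
  proof -
    have "\<exists>B. \<forall>\<^sub>F z in at z0. cmod (cinner (F z x) y) \<le> B"
      by (rule exI[of _ "C * norm x * norm y"], rule eventually_mono[OF ev], rule bound)
    then show ?thesis
      using holomorphic_on_extend_bounded[OF hol] \<open>0 < r\<close> by simp
  qed
  then obtain h where h: "\<And>x y. h x y holomorphic_on ball z0 r"
    "\<And>x y z. z \<in> ball z0 r - {z0} \<Longrightarrow> h x y z = cinner (F z x) y"
    by metis
  have h_lim: "((\<lambda>z. cinner (F z x) y) \<longlongrightarrow> h x y z0) (at z0)" for x y
  proof (rule Lim_transform_eventually)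
    show "(h x y \<longlongrightarrow> h x y z0) (at z0)"
      using h(1)[of x y] \<open>0 < r\<close> holomorphic_on_imp_continuous_on[of "h x y" "ball z0 r"]
      by (simp add: continuous_on_eq_continuous_at isCont_def)
    show "\<forall>\<^sub>F z in at z0. h x y z = cinner (F z x) y"
      using ev by eventually_elim (rule h(2))
  qed
  have h_bound: "cmod (h x y z) \<le> C * norm x * norm y" if "z \<in> ball z0 r" for x y z
  proof (cases "z = z0")
    case True
    show ?thesis unfolding True
      by (rule tendsto_upperbound[OF tendsto_norm[OF h_lim]])
        (use ev in eventually_elim, auto intro: bound)
  qed (use that h(2) bound in simp)
  \<comment> \<open>Cauchy's estimates for the extensions \<open>h x y\<close> are uniform in
    \<open>y\<close>, so \<open>F\<close> is Lipschitz in norm near \<open>z0\<close> and has a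
    strong limit there.\<close>
  have lip: "norm (F w x - F w' x) \<le> 2 * C / r * norm x * cmod (w - w')"
    if w: "w \<in> ball z0 (r/2) - {z0}" "w' \<in> ball z0 (r/2) - {z0}" for w w' x
  proof (rule norm_le_if_cinner_le)
    show "0 \<le> 2 * C / r * norm x * cmod (w - w')" using \<open>0 < r\<close> \<open>0 \<le> C\<close> by simp
    fix y
    have "cmod (h x y w - h x y w') \<le> 2 * (C * norm x * norm y) / r * cmod (w - w')"
      using holomorphic_bounded_lipschitz(2)[OF h(1) \<open>0 < r\<close> h_bound] w by blast
    moreover have "h x y w - h x y w' = cinner (F w x - F w' x) y"
      using h(2)[of w x y] h(2)[of w' x y] w \<open>0 < r\<close> by (simp add: cinner_diff_left)
    ultimately show "cmod (cinner (F w x - F w' x) y) \<le> 2 * C / r * norm x * cmod (w - w') * norm y"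
      by (simp add: mult_ac)
  qed
  have z0: "z0 \<in> ball z0 (r/2)" and "0 \<le> 2 * C / r"
    using \<open>0 < r\<close> \<open>0 \<le> C\<close> by auto
  have F2: "\<And>w. w \<in> ball z0 (r/2) - {z0} \<Longrightarrow> bounded_clinear (F w)"
    by (rule F) (use \<open>0 < r\<close> in auto)
  obtain D where D: "bounded_clinear D" "\<And>x. ((\<lambda>w. F w x) \<longlongrightarrow> D x) (at z0)"
    using lipschitz_family_limit[of "ball z0 (r/2)" z0 "2 * C / r" F] z0 \<open>0 \<le> 2 * C / r\<close> F2 lip
    by auto
  have F'h: "cinner ((F(z0 := D)) z x) y = h x y z" if "z \<in> ball z0 r" for z x y
  proof (cases "z = z0")
    case True
    then show ?thesis
      using tendsto_unique[OF _ tendsto_cinner_left[OF D(2)] h_lim] by simp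
  qed (use that h(2) in simp)
  have "op_analytic_on (F(z0 := D)) (ball z0 (r/4))"
  proof (rule op_analytic_on_if_weakly_holomorphic[OF \<open>0 < r\<close> \<open>0 \<le> C\<close>])
    show "bounded_clinear ((F(z0 := D)) z)" if "z \<in> ball z0 r" for z
      using that D(1) F by simp
    show "(\<lambda>z. cinner ((F(z0 := D)) z x) y) holomorphic_on ball z0 r" for x y
      using h(1)[of x y] by (rule holomorphic_transform) (simp only: F'h)
    show "cmod (cinner ((F(z0 := D)) z x) y) \<le> C * norm x * norm y" if "z \<in> ball z0 r" for z x y
      using that F'h h_bound by simp
  qed
  then show ?thesis by (intro exI[of _ "F(z0 := D)"]) simp
qed

section \<open>Resolvents\<close>

lemma resolvent_solves:
  assumes "z \<in> resolvent_set T"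
  shows "resolvent T z x \<in> Domain T"
    "op_app T (resolvent T z x) = x + z *\<^sub>C resolvent T z x"
proof -
  have bij: "bij_betw (\<lambda>u. op_app T u - z *\<^sub>C u) (Domain T) UNIV"
    using assms by (simp add: resolvent_set_def)
  then have x: "x \<in> (\<lambda>u. op_app T u - z *\<^sub>C u) ` Domain T"
    by (simp add: bij_betw_def)
  show "resolvent T z x \<in> Domain T"
    unfolding resolvent_def by (rule inv_into_into[OF x])
  show "op_app T (resolvent T z x) = x + z *\<^sub>C resolvent T z x"
    using f_inv_into_f[OF x] by (simp add: resolvent_def algebra_simps)
qed

lemma resolvent_eqI:
  assumes "z \<in> resolvent_set T" "u \<in> Domain T" "op_app T u = x + z *\<^sub>C u"
  shows "resolvent T z x = u"
proof -
  have "inj_on (\<lambda>u. op_app T u - z *\<^sub>C u) (Domain T)"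
    using assms(1) by (simp add: resolvent_set_def bij_betw_def)
  from inv_into_f_f[OF this assms(2)] show ?thesis
    by (simp add: resolvent_def assms(3))
qed

lemma bounded_clinear_resolvent:
  "z \<in> resolvent_set T \<Longrightarrow> bounded_clinear (resolvent T z)"
  by (simp add: resolvent_set_def)

text \<open>The vector \<open>resolvent T z x\<close> solves the equation at \<open>w\<close> with
  right-hand side \<open>x + (z - w) *\<^sub>C ?u\<close>. Linearity of the resolvent at
  \<open>w\<close> then yields the identity.\<close>

lemma resolvent_identity:
  assumes w: "w \<in> resolvent_set T" and z: "z \<in> resolvent_set T"
  shows "resolvent T w x - resolvent T z x = (w - z) *\<^sub>C resolvent T w (resolvent T z x)"
proof -
  note R = bounded_clinearD[OF bounded_clinear_resolvent[OF w]]
  let ?u = "resolvent T z x"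
  have "resolvent T w (x + (z - w) *\<^sub>C ?u) = ?u"
    by (rule resolvent_eqI[OF w])
      (simp_all add: resolvent_solves[OF z] complex_vector.scale_left_diff_distrib)
  then have "resolvent T w x + (z - w) *\<^sub>C resolvent T w ?u = ?u"
    by (simp add: R)
  then show ?thesis
    by (simp add: complex_vector.scale_left_diff_distrib algebra_simps)
qed

text \<open>In the resolvent identity the resolvent at \<open>w\<close> reappears on the right.
  Within distance \<open>1 / (2 * K)\<close> of \<open>z\<close> that term is at most half of the
  left side and is absorbed.\<close>

lemma resolvent_locally_bounded:
  assumes z: "z \<in> resolvent_set T"
  obtains e C where "0 < e" "0 \<le> C"
    "\<And>w x. w \<in> resolvent_set T \<Longrightarrow> dist w z < e \<Longrightarrow> norm (resolvent T w x) \<le> C * norm x"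
proof -
  obtain K where K: "K > 0" "\<And>x. norm (resolvent T z x) \<le> K * norm x"
    using bounded_clinear_pos_bound[OF bounded_clinear_resolvent[OF z]] by blast
  have "norm (resolvent T w x) \<le> 2 * K * norm x"
    if w: "w \<in> resolvent_set T" "dist w z < 1 / (2 * K)" for w x
  proof -
    let ?n = "norm (resolvent T w x)"
    have "resolvent T w x = resolvent T z x - (z - w) *\<^sub>C resolvent T z (resolvent T w x)"
      using resolvent_identity[OF z w(1), of x] by (simp add: algebra_simps)
    then have "?n \<le> norm (resolvent T z x) + cmod (z - w) * norm (resolvent T z (resolvent T w x))"
      using norm_triangle_ineq4[of "resolvent T z x" "(z - w) *\<^sub>C resolvent T z (resolvent T w x)"]
      by (simp add: norm_scaleC)
    also have "\<dots> \<le> K * norm x + 1 / (2 * K) * (K * ?n)"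
      using w(2) K by (intro add_mono mult_mono) (auto simp: dist_norm norm_minus_commute)
    also have "\<dots> = K * norm x + ?n / 2" using K(1) by simp
    finally show ?thesis by simp
  qed
  then show thesis
    using that[of "1 / (2 * K)" "2 * K"] K(1) by simp
qed

lemma resolvent_bounded_on_compact:
  assumes "compact X" "X \<subseteq> resolvent_set T"
  obtains C where "0 \<le> C" "\<And>w x. w \<in> X \<Longrightarrow> norm (resolvent T w x) \<le> C * norm x"
proof -
  have "\<exists>e C. 0 < e \<and> 0 \<le> C \<and> (\<forall>w\<in>resolvent_set T. dist w z < e \<longrightarrow>
      (\<forall>x. norm (resolvent T w x) \<le> C * norm x))" if "z \<in> X" for z
    using that assms(2) resolvent_locally_bounded[of z T] by (metis subsetD)
  then obtain e C where eC: "\<And>z. z \<in> X \<Longrightarrow> 0 < e z" "\<And>z. z \<in> X \<Longrightarrow> 0 \<le> C z"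
    "\<And>z w x. z \<in> X \<Longrightarrow> w \<in> resolvent_set T \<Longrightarrow> dist w z < e z \<Longrightarrow>
      norm (resolvent T w x) \<le> C z * norm x"
    by metis
  have "X \<subseteq> (\<Union>z\<in>X. ball z (e z))" using eC(1) by auto
  then obtain D where D: "D \<subseteq> X" "finite D" "X \<subseteq> (\<Union>z\<in>D. ball z (e z))"
    using compactE_image[OF assms(1), of X "\<lambda>z. ball z (e z)"] by auto
  show thesis
  \<comment> \<open>The sum of the nonnegative local constants over the finite subcover dominates
    each of them.\<close>
  proof (rule that[of "sum C D"])
    show "0 \<le> sum C D" using D(1) eC(2) by (auto intro: sum_nonneg)
    fix w x assume w: "w \<in> X"
    then obtain z where z: "z \<in> D" "dist w z < e z"
      using D(3) by (auto simp: dist_commute)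
    have "norm (resolvent T w x) \<le> C z * norm x"
      using eC(3) z D(1) w assms(2) by blast
    also have "\<dots> \<le> sum C D * norm x"
      using z(1) D(1,2) eC(2) by (intro mult_right_mono member_le_sum) auto
    finally show "norm (resolvent T w x) \<le> sum C D * norm x" .
  qed
qed

lemma tendsto_resolvent:
  assumes z: "z \<in> resolvent_set T"
  shows "((\<lambda>w. resolvent T w x) \<longlongrightarrow> resolvent T z x) (at z within resolvent_set T)"
proof -
  obtain e C where eC: "0 < e" "0 \<le> C"
    "\<And>w x. w \<in> resolvent_set T \<Longrightarrow> dist w z < e \<Longrightarrow> norm (resolvent T w x) \<le> C * norm x"
    using resolvent_locally_bounded[OF z] by blast
  have "\<forall>\<^sub>F w in at z within resolvent_set T.
      norm (resolvent T w x - resolvent T z x) \<le> cmod (w - z) * (C * norm (resolvent T z x))"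
    unfolding eventually_at using eC
    by (intro exI[of _ e])
      (auto simp: resolvent_identity[OF _ z] norm_scaleC intro!: mult_left_mono)
  moreover have "((\<lambda>w. cmod (w - z) * (C * norm (resolvent T z x)))
      \<longlongrightarrow> cmod (z - z) * (C * norm (resolvent T z x))) (at z within resolvent_set T)"
    by (intro tendsto_intros)
  ultimately show ?thesis
    using LIM_zero_cancel Lim_null_comparison by fastforce
qed

text \<open>By the resolvent identity the difference quotient is a matrix element of the product of
  the resolvents at \<open>w\<close> and \<open>z\<close>. Strong continuity gives the square of the
  resolvent as derivative, all limits being taken within the resolvent set.\<close>

lemma holomorphic_on_cinner_resolvent:
  "(\<lambda>z. cinner (resolvent T z x) y) holomorphic_on resolvent_set T"
  unfolding holomorphic_on_def field_differentiable_def has_field_derivative_iff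
proof (intro ballI exI)
  fix z assume z: "z \<in> resolvent_set T"
  show "((\<lambda>w. (cinner (resolvent T w x) y - cinner (resolvent T z x) y) / (w - z))
      \<longlongrightarrow> cinner (resolvent T z (resolvent T z x)) y) (at z within resolvent_set T)"
  proof (rule Lim_transform_eventually[OF tendsto_cinner_left[OF tendsto_resolvent[OF z]]])
    show "\<forall>\<^sub>F w in at z within resolvent_set T. cinner (resolvent T w (resolvent T z x)) y
        = (cinner (resolvent T w x) y - cinner (resolvent T z x) y) / (w - z)"
      unfolding eventually_at
      by (intro exI[of _ 1])
        (auto simp: resolvent_identity[OF _ z] cinner_scaleC_left simp flip: cinner_diff_left)
  qed
qed

text \<open>The maximum principle turns a resolvent bound on the circle into a bound on the disc that is
  uniform on the spans and hence passes to their closures.\<close>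

lemma cinner_resolvent_bounded_if_limits:
  assumes r: "0 < r" "cball z0 r - {z0} \<subseteq> resolvent_set T"
    and lim: "\<And>x y. x \<in> X \<Longrightarrow> y \<in> Y \<Longrightarrow> \<exists>l. ((\<lambda>z. cinner (resolvent T z x) y) \<longlongrightarrow> l) (at z0)"
  obtains C where "0 \<le> C" "\<And>z x y. z \<in> ball z0 r - {z0} \<Longrightarrow> x \<in> closure (cspan X) \<Longrightarrow>
    y \<in> closure (cspan Y) \<Longrightarrow> cmod (cinner (resolvent T z x) y) \<le> C * norm x * norm y"
proof -
  have ev: "\<forall>\<^sub>F z in at z0. z \<in> ball z0 r - {z0}"
    by (rule eventually_at_punctured) (use r(1) in auto)
  have bc: "bounded_clinear (resolvent T z)" if "z \<in> ball z0 r - {z0}" for z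
    using r(2) that by (intro bounded_clinear_resolvent) auto
  \<comment> \<open>With one argument fixed, the vectors for which the limit exists form a subspace.
    Hence \<open>Q\<close> passes from \<open>X\<close> to its span and then from \<open>Y\<close>
    to its span.\<close>
  define Q where "Q x y \<longleftrightarrow> (\<exists>l. ((\<lambda>z. cinner (resolvent T z x) y) \<longlongrightarrow> l) (at z0))" for x y
  have Q_left: "csubspace {x. Q x y}" for y
    unfolding complex_vector.subspace_def
  proof (intro conjI ballI allI)
    show "0 \<in> {x. Q x y}"
      using ev bounded_clinearD(3)[OF bc, of _ 0 0]
      by (auto simp: Q_def intro!: exI[of _ 0] tendsto_eventually elim!: eventually_mono)
    show "a + b \<in> {x. Q x y}" if ab: "a \<in> {x. Q x y}" "b \<in> {x. Q x y}" for a b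
    proof -
      obtain l m where "((\<lambda>z. cinner (resolvent T z a) y) \<longlongrightarrow> l) (at z0)"
        "((\<lambda>z. cinner (resolvent T z b) y) \<longlongrightarrow> m) (at z0)"
        using ab by (auto simp: Q_def)
      from tendsto_add[OF this] have "((\<lambda>z. cinner (resolvent T z (a + b)) y) \<longlongrightarrow> l + m) (at z0)"
        by (rule Lim_transform_eventually)
          (use ev in eventually_elim, simp add: bounded_clinearD[OF bc] cinner_add_left)
      then show ?thesis by (auto simp: Q_def)
    qed
    show "c *\<^sub>C a \<in> {x. Q x y}" if a: "a \<in> {x. Q x y}" for c a
    proof -
      obtain l where "((\<lambda>z. cinner (resolvent T z a) y) \<longlongrightarrow> l) (at z0)"
        using a by (auto simp: Q_def)
      from tendsto_mult[OF tendsto_const[of c] this]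
      have "((\<lambda>z. cinner (resolvent T z (c *\<^sub>C a)) y) \<longlongrightarrow> c * l) (at z0)"
        by (rule Lim_transform_eventually)
          (use ev in eventually_elim, simp add: bounded_clinearD[OF bc] cinner_scaleC_left)
      then show ?thesis by (auto simp: Q_def)
    qed
  qed
  have Q_right: "csubspace {y. Q x y}" for x
    unfolding complex_vector.subspace_def
  proof (intro conjI ballI allI)
    show "0 \<in> {y. Q x y}" by (auto simp: Q_def)
    show "a + b \<in> {y. Q x y}" if "a \<in> {y. Q x y}" "b \<in> {y. Q x y}" for a b
      using that unfolding Q_def mem_Collect_eq cinner_add_right by (metis tendsto_add)
    show "c *\<^sub>C a \<in> {y. Q x y}" if "a \<in> {y. Q x y}" for c a
      using that unfolding Q_def mem_Collect_eq cinner_scaleC_right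
      by (metis tendsto_mult_left)
  qed
  have "Q x y" if "x \<in> cspan X" "y \<in> Y" for x y
    using complex_vector.span_minimal[OF _ Q_left, of X y] lim that by (auto simp: Q_def)
  then have Q: "Q x y" if "x \<in> cspan X" "y \<in> cspan Y" for x y
    using complex_vector.span_minimal[OF _ Q_right, of Y x] that by blast
  have "sphere z0 r \<subseteq> resolvent_set T"
    using r by (auto simp: subset_iff)
  then obtain C where C: "0 \<le> C"
    "\<And>w x. w \<in> sphere z0 r \<Longrightarrow> norm (resolvent T w x) \<le> C * norm x"
    using resolvent_bounded_on_compact[OF compact_sphere] by blast
  have span_bound: "cmod (cinner (resolvent T z x) y) \<le> C * norm x * norm y"
    if z: "z \<in> ball z0 r - {z0}" and xy: "x \<in> cspan X" "y \<in> cspan Y" for z x y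
  proof -
    obtain l where l: "((\<lambda>z. cinner (resolvent T z x) y) \<longlongrightarrow> l) (at z0)"
      using Q[OF xy] by (auto simp: Q_def)
    \<comment> \<open>Inserting the limit at \<open>z0\<close> makes \<open>f\<close> continuous on
      the closed disc, hence holomorphic inside, so that its values on the circle bound it.\<close>
    define f where "f z = (if z = z0 then l else cinner (resolvent T z x) y)" for z
    have "(\<lambda>z. cinner (resolvent T z x) y) holomorphic_on ball z0 r - {z0}"
      using r(2) ball_subset_cball
      by (intro holomorphic_on_subset[OF holomorphic_on_cinner_resolvent]) blast
    then have f1: "f holomorphic_on ball z0 r - {z0}"
      by (rule holomorphic_transform) (simp add: f_def)
    have f2: "continuous_on (cball z0 r) f"
      unfolding continuous_on_def
    proof
      fix z assume z: "z \<in> cball z0 r"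
      show "(f \<longlongrightarrow> f z) (at z within cball z0 r)"
      proof (cases "z = z0")
        case True
        have "(f \<longlongrightarrow> l) (at z0)"
          by (rule Lim_transform_eventually[OF l])
            (auto simp: f_def eventually_at_filter)
        then show ?thesis
          unfolding True using tendsto_mono[OF at_le[OF subset_UNIV]] by (auto simp: f_def)
      next
        case False
        have zR: "z \<in> resolvent_set T" using z False r(2) by auto
        have "((\<lambda>z. cinner (resolvent T z x) y) \<longlongrightarrow> cinner (resolvent T z x) y)
            (at z within cball z0 r - {z0})"
          using tendsto_cinner_left[OF tendsto_resolvent[OF zR]] r(2)
          by (rule tendsto_within_subset)
        moreover have "at z within cball z0 r - {z0} = at z within cball z0 r"
          by (rule at_within_nhd[of z "- {z0}"]) (use False in auto)
        ultimately have "((\<lambda>z. cinner (resolvent T z x) y) \<longlongrightarrow> cinner (resolvent T z x) y)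
            (at z within cball z0 r)" by simp
        then have "(f \<longlongrightarrow> cinner (resolvent T z x) y) (at z within cball z0 r)"
        proof (rule Lim_transform_eventually)
          show "\<forall>\<^sub>F w in at z within cball z0 r. cinner (resolvent T w x) y = f w"
            unfolding eventually_at f_def using False
            by (intro exI[of _ "dist z z0"]) (auto simp: dist_commute)
        qed
        then show ?thesis using False by (simp add: f_def)
      qed
    qed
    have "f holomorphic_on ball z0 r"
      by (rule no_isolated_singularity[OF _ f1 open_ball])
        (use f2 ball_subset_cball continuous_on_subset in blast)+
    then have f3: "f holomorphic_on interior (cball z0 r)" by simp
    have f4: "continuous_on (closure (cball z0 r)) f" using f2 by simp
    have "z \<in> cball z0 r" using z by auto
    have "cmod (f z) \<le> C * norm x * norm y"
    proof (rule maximum_modulus_frontier[OF f3 f4 bounded_cball _ \<open>z \<in> cball z0 r\<close>])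
      fix w assume "w \<in> frontier (cball z0 r)"
      then have w: "w \<in> sphere z0 r" by simp
      then have "w \<noteq> z0" using r(1) by auto
      then have "cmod (f w) \<le> norm (resolvent T w x) * norm y"
        by (simp add: f_def cinner_cauchy_schwarz)
      also have "\<dots> \<le> C * norm x * norm y"
        by (rule mult_right_mono[OF C(2)[OF w]]) simp
      finally show "cmod (f w) \<le> C * norm x * norm y" .
    qed
    then show ?thesis using z by (simp add: f_def)
  qed
  show thesis
  proof (rule that[OF C(1)])
    fix z x y
    assume z: "z \<in> ball z0 r - {z0}" and xy: "x \<in> closure (cspan X)" "y \<in> closure (cspan Y)"
    \<comment> \<open>The constant \<open>C\<close> comes from the circle and is the same for all
      vectors, so for fixed \<open>z\<close> the bound survives approximation in both
      arguments.\<close>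
    obtain f g where f: "\<And>n. f n \<in> cspan X" "f \<longlonglongrightarrow> x" and g: "\<And>n. g n \<in> cspan Y" "g \<longlonglongrightarrow> y"
      using xy unfolding closure_sequential by metis
    have "(\<lambda>n. resolvent T z (f n)) \<longlonglongrightarrow> resolvent T z x"
      using bc[OF z] f(2) by (auto simp: bounded_clinear_def intro: bounded_linear.tendsto)
    then have "(\<lambda>n. cinner (resolvent T z (f n)) (g n)) \<longlonglongrightarrow> cinner (resolvent T z x) y"
      using g(2) by (rule bounded_bilinear.tendsto[OF bounded_bilinear_cinner])
    from tendsto_norm[OF this]
    show "cmod (cinner (resolvent T z x) y) \<le> C * norm x * norm y"
    proof (rule LIMSEQ_le)
      show "(\<lambda>n. C * norm (f n) * norm (g n)) \<longlonglongrightarrow> C * norm x * norm y"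
        by (intro tendsto_intros f g)
    qed (use span_bound[OF z f(1) g(1)] in blast)
  qed
qed

section \<open>Boundary triplets\<close>

lemma mem_op_adjoint:
  "p \<in> op_adjoint T \<longleftrightarrow> (\<forall>u u'. (u, u') \<in> T \<longrightarrow> cinner u' (fst p) = cinner u (snd p))"
  by (auto simp: op_adjoint_def)

lemma csubspace_op_adjoint: "csubspace (op_adjoint T)"
proof (rule complex_vector.subspaceI)
  show "0 \<in> op_adjoint T" by (simp add: mem_op_adjoint)
next
  fix p q assume pq: "p \<in> op_adjoint T" "q \<in> op_adjoint T"
  show "p + q \<in> op_adjoint T"
    unfolding mem_op_adjoint
  proof (intro allI impI)
    fix u u' assume "(u, u') \<in> T"
    then have "cinner u' (fst p) = cinner u (snd p)" "cinner u' (fst q) = cinner u (snd q)"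
      using pq unfolding mem_op_adjoint by blast+
    then show "cinner u' (fst (p + q)) = cinner u (snd (p + q))"
      by (simp only: fst_add snd_add cinner_add_right)
  qed
next
  fix c p assume p: "p \<in> op_adjoint T"
  show "c *\<^sub>C p \<in> op_adjoint T"
    unfolding mem_op_adjoint
  proof (intro allI impI)
    fix u u' assume "(u, u') \<in> T"
    then have "cinner u' (fst p) = cinner u (snd p)"
      using p unfolding mem_op_adjoint by blast
    then show "cinner u' (fst (c *\<^sub>C p)) = cinner u (snd (c *\<^sub>C p))"
      by (simp only: scaleC_prod_def fst_conv snd_conv cinner_scaleC_right)
  qed
qed

lemma single_valued_op_adjoint:
  fixes T :: "('a::complex_inner \<times> 'b::complex_inner) set"
  assumes "densely_defined T"
  shows "single_valued (op_adjoint T)"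
proof (rule single_valuedI)
  fix v w w' assume vw: "(v, w) \<in> op_adjoint T" "(v, w') \<in> op_adjoint T"
  have "closure (Domain T) \<subseteq> {u. cinner u w = cinner u w'}"
  proof (rule closure_minimal)
    show "closed {u. cinner u w = cinner u w'}"
      by (intro closed_Collect_eq linear_continuous_on bounded_linear_cinner_left)
    show "Domain T \<subseteq> {u. cinner u w = cinner u w'}"
    proof clarify
      fix u u' assume "(u, u') \<in> T"
      then have "cinner u' v = cinner u w" "cinner u' v = cinner u w'"
        using vw by (auto simp: mem_op_adjoint)
      then show "cinner u w = cinner u w'" by simp
    qed
  qed
  then have "cinner u w = cinner u w'" for u
    using assms by (auto simp: densely_defined_def)
  then show "w = w'" by (rule cinner_eqI)
qed

lemma op_app_eq: "single_valued T \<Longrightarrow> (u, w) \<in> T \<Longrightarrow> op_app T u = w"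
  unfolding op_app_def single_valued_def by blast

lemma op_app_mem: "single_valued T \<Longrightarrow> u \<in> Domain T \<Longrightarrow> (u, op_app T u) \<in> T"
  using op_app_eq by fastforce

lemma linear_operator_app:
  assumes "linear_operator T" "u \<in> Domain T" "v \<in> Domain T"
  shows "u + v \<in> Domain T" "op_app T (u + v) = op_app T u + op_app T v"
    "c *\<^sub>C u \<in> Domain T" "op_app T (c *\<^sub>C u) = c *\<^sub>C op_app T u"
proof -
  have T: "csubspace T" "single_valued T"
    using assms(1) by (auto simp: linear_operator_def)
  have "(u + v, op_app T u + op_app T v) \<in> T"
    using complex_vector.subspace_add[OF T(1) op_app_mem[OF T(2) assms(2)] op_app_mem[OF T(2) assms(3)]]
    by simp
  then show "u + v \<in> Domain T" "op_app T (u + v) = op_app T u + op_app T v"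
    using op_app_eq[OF T(2)] by auto
  have "(c *\<^sub>C u, c *\<^sub>C op_app T u) \<in> T"
    using complex_vector.subspace_scale[OF T(1) op_app_mem[OF T(2) assms(2)], of c]
    by (simp add: scaleC_prod_def)
  then show "c *\<^sub>C u \<in> Domain T" "op_app T (c *\<^sub>C u) = c *\<^sub>C op_app T u"
    using op_app_eq[OF T(2)] by auto
qed

lemma restrict_ker_app:
  assumes "single_valued T"
  shows "Domain (restrict_ker T G) = {u \<in> Domain T. G u = 0}"
    and "u \<in> Domain (restrict_ker T G) \<Longrightarrow> op_app (restrict_ker T G) u = op_app T u"
proof -
  show "Domain (restrict_ker T G) = {u \<in> Domain T. G u = 0}"
    by (auto simp: restrict_ker_def)
  have "single_valued (restrict_ker T G)"
    using assms by (auto simp: restrict_ker_def single_valued_def)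
  then show "u \<in> Domain (restrict_ker T G) \<Longrightarrow> op_app (restrict_ker T G) u = op_app T u"
    using op_app_mem op_app_eq[OF assms] by (metis (no_types, lifting) restrict_ker_def case_prodE mem_Collect_eq Pair_inject)
qed

lemma solution_range_subset: "solution_range T G \<mu> \<subseteq> eigenspace T \<mu>"
  unfolding solution_range_def solution_operator_def by (auto intro: inv_into_into)

text \<open>This is Green's formula with the boundary operator \<open>B\<close> absorbed into
  \<open>G\<close> and \<open>Gt\<close>. On their kernels the right-hand side vanishes, so the two
  restrictions are formally adjoint.\<close>

locale green_pair =
  fixes T T' :: "('a::complex_inner \<times> 'a) set"
    and \<Gamma>t2 :: "'a \<Rightarrow> 'h::complex_inner"
    and \<Gamma>2 :: "'a \<Rightarrow> 'k::complex_inner"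
    and G :: "'a \<Rightarrow> 'h" and Gt :: "'a \<Rightarrow> 'k"
  assumes T: "linear_operator T" and T': "linear_operator T'"
    and G: "clinear_on (Domain T) G"
    and green: "u \<in> Domain T \<Longrightarrow> v \<in> Domain T' \<Longrightarrow>
      cinner (op_app T u) v - cinner u (op_app T' v) =
      cinner (G u) (\<Gamma>t2 v) - cinner (\<Gamma>2 u) (Gt v)"
begin

abbreviation "TG \<equiv> restrict_ker T G"
abbreviation "TG' \<equiv> restrict_ker T' Gt"

lemma TG_app: "u \<in> Domain TG \<longleftrightarrow> u \<in> Domain T \<and> G u = 0"
  "u \<in> Domain TG \<Longrightarrow> op_app TG u = op_app T u"
  using T by (simp_all add: linear_operator_def restrict_ker_app)

lemma TG'_app: "v \<in> Domain TG' \<longleftrightarrow> v \<in> Domain T' \<and> Gt v = 0"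
  "v \<in> Domain TG' \<Longrightarrow> op_app TG' v = op_app T' v"
  using T' by (simp_all add: linear_operator_def restrict_ker_app)

lemma cinner_TG_TG':
  assumes "u \<in> Domain TG" "v \<in> Domain TG'"
  shows "cinner (op_app TG u) v = cinner u (op_app TG' v)"
  using green[of u v] assms by (simp add: TG_app TG'_app)

text \<open>Formal adjointness moves the operator from one resolvent to the other. For
  \<open>z \<noteq> cnj \<epsilon>\<close> this removes the resolvent of \<open>TG'\<close> next to
  the resolvent of \<open>TG\<close>.\<close>

lemma cinner_resolvent_resolvent:
  assumes z: "z \<in> resolvent_set TG" and e: "\<epsilon> \<in> resolvent_set TG'"
  shows "(z - cnj \<epsilon>) * cinner (resolvent TG z x) (resolvent TG' \<epsilon> y)
    = cinner (resolvent TG z x) y - cinner x (resolvent TG' \<epsilon> y)"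
proof -
  let ?u = "resolvent TG z x" and ?v = "resolvent TG' \<epsilon> y"
  have "cinner (x + z *\<^sub>C ?u) ?v = cinner ?u (y + \<epsilon> *\<^sub>C ?v)"
    using cinner_TG_TG'[OF resolvent_solves(1)[OF z, of x] resolvent_solves(1)[OF e, of y]]
    by (simp only: resolvent_solves(2)[OF z] resolvent_solves(2)[OF e])
  then have "cinner x ?v + z * cinner ?u ?v = cinner ?u y + cnj \<epsilon> * cinner ?u ?v"
    by (simp only: cinner_add_left cinner_add_right cinner_scaleC_left cinner_scaleC_right)
  then show ?thesis by (simp add: algebra_simps)
qed

text \<open>With \<open>v\<close> the resolvent of \<open>TG'\<close> at \<open>\<epsilon>\<close> applied to \<open>resolvent TG z x\<close>, the previous identity
  expresses the squared norm of \<open>resolvent TG z x\<close>, and the term with the factor \<open>z - cnj \<epsilon>\<close> can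
  be absorbed.\<close>

lemma resolvent_bounded_near_cnj:
  assumes e: "\<epsilon> \<in> resolvent_set TG'"
  obtains d C where "0 < d" "0 \<le> C"
    "\<And>z x. z \<in> resolvent_set TG \<Longrightarrow> dist z (cnj \<epsilon>) < d \<Longrightarrow> norm (resolvent TG z x) \<le> C * norm x"
proof -
  obtain K where K: "K > 0" "\<And>y. norm (resolvent TG' \<epsilon> y) \<le> K * norm y"
    using bounded_clinear_pos_bound[OF bounded_clinear_resolvent[OF e]] by blast
  have "norm (resolvent TG z x) \<le> 2 * K * norm x"
    if z: "z \<in> resolvent_set TG" "dist z (cnj \<epsilon>) < 1 / (2 * K)" for z x
  proof (cases "resolvent TG z x = 0")
    case False
    let ?u = "resolvent TG z x"
    let ?v = "resolvent TG' \<epsilon> ?u"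
    have "norm ?u * norm ?u = cmod (cinner ?u ?u)"
      by (simp add: cinner_self norm_mult power2_eq_square)
    also have "cinner ?u ?u = cinner x ?v + (z - cnj \<epsilon>) * cinner ?u ?v"
      using cinner_resolvent_resolvent[OF z(1) e, of x ?u] by (simp add: algebra_simps)
    also have "cmod \<dots> \<le> cmod (cinner x ?v) + cmod (z - cnj \<epsilon>) * cmod (cinner ?u ?v)"
      using norm_triangle_ineq[of "cinner x ?v" "(z - cnj \<epsilon>) * cinner ?u ?v"]
      by (simp add: norm_mult)
    also have "\<dots> \<le> norm x * (K * norm ?u) + 1 / (2 * K) * (norm ?u * (K * norm ?u))"
    proof (intro add_mono mult_mono)
      show "cmod (cinner x ?v) \<le> norm x * (K * norm ?u)" for x
        by (rule order_trans[OF cinner_cauchy_schwarz mult_left_mono[OF K(2)]]) simp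
      then show "cmod (cinner ?u ?v) \<le> norm ?u * (K * norm ?u)" .
    qed (use z(2) K(1) in \<open>auto simp: dist_norm\<close>)
    also have "\<dots> = (K * norm x + norm ?u / 2) * norm ?u"
      using K(1) by (simp add: algebra_simps)
    finally have "norm ?u \<le> K * norm x + norm ?u / 2"
      using False by (simp add: mult_le_cancel_right)
    then show ?thesis by simp
  qed (use K(1) in simp)
  then show thesis
    using that[of "1 / (2 * K)" "2 * K"] K(1) by simp
qed

section \<open>Solutions of the eigenvalue equation and the M-function\<close>

lemma eigenspace_shift:
  assumes z: "z \<in> resolvent_set TG" and x: "x \<in> eigenspace T \<mu>"
  shows "x + (z - \<mu>) *\<^sub>C resolvent TG z x \<in> eigenspace T z"
    and "G (x + (z - \<mu>) *\<^sub>C resolvent TG z x) = G x"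
proof -
  let ?u = "resolvent TG z x"
  have x: "x \<in> Domain T" "op_app T x = \<mu> *\<^sub>C x"
    using x by (auto simp: eigenspace_def)
  have u: "?u \<in> Domain T" "G ?u = 0" "op_app T ?u = x + z *\<^sub>C ?u"
    using resolvent_solves[OF z, of x] TG_app by auto
  note lin = linear_operator_app[OF T]
  have zu: "(z - \<mu>) *\<^sub>C ?u \<in> Domain T" by (rule lin(3)[OF u(1) u(1)])
  \<comment> \<open>Applying \<open>T - z\<close> gives
    \<open>(\<mu> - z) *\<^sub>C x + (z - \<mu>) *\<^sub>C x\<close>, which is 0. The boundary value
    below is unchanged since \<open>G ?u = 0\<close>.\<close>
  show "x + (z - \<mu>) *\<^sub>C ?u \<in> eigenspace T z"
    using lin(1,2)[OF x(1) zu] lin(4)[OF u(1) u(1), of "z - \<mu>"]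
    by (simp add: eigenspace_def x(2) u(3) scaleC_add_right scaleC_scaleC mult.commute
        complex_vector.scale_left_diff_distrib algebra_simps)
  have "G (x + (z - \<mu>) *\<^sub>C ?u) = G x + (z - \<mu>) *\<^sub>C G ?u"
    using G x(1) u(1) zu unfolding clinear_on_def by metis
  then show "G (x + (z - \<mu>) *\<^sub>C ?u) = G x"
    by (simp add: u(2))
qed

text \<open>Two solutions with equal boundary value differ by an element of the kernel of
  \<open>TG - z\<close>, which is trivial on the resolvent set. So the description in
  \<open>M_function\<close> is unique.\<close>

lemma M_function_eq:
  assumes z: "z \<in> resolvent_set TG" and u: "u \<in> eigenspace T z"
  shows "M_function T G \<Gamma>2 z (G u) = \<Gamma>2 u"
proof -
  have "v = u" if v: "v \<in> eigenspace T z" "G v = G u" for v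
  proof -
    have D: "u \<in> Domain T" "v \<in> Domain T" "op_app T u = z *\<^sub>C u" "op_app T v = z *\<^sub>C v"
      using u v by (auto simp: eigenspace_def)
    note lin = linear_operator_app[OF T]
    have neg: "(-1) *\<^sub>C u \<in> Domain T" by (rule lin(3)[OF D(1) D(1)])
    let ?w = "v + (-1) *\<^sub>C u"
    have "G ?w = G v + (-1) *\<^sub>C G u"
      using G D(1,2) neg unfolding clinear_on_def by metis
    then have "?w \<in> Domain TG"
      using lin(1)[OF D(2) neg] v(2) by (simp add: TG_app)
    moreover have "op_app TG ?w = 0 + z *\<^sub>C ?w"
      using \<open>?w \<in> Domain TG\<close> lin(2)[OF D(2) neg] lin(4)[OF D(1) D(1), of "-1"] D(3,4)
      by (simp add: TG_app complex_vector.scale_right_diff_distrib)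
    ultimately have "resolvent TG z 0 = ?w" by (rule resolvent_eqI[OF z])
    moreover have "resolvent TG z 0 = 0"
      using bounded_clinearD(2)[OF bounded_clinear_resolvent[OF z], of 0 0] by simp
    ultimately show ?thesis by simp
  qed
  then show ?thesis
    unfolding M_function_def using u by (intro the_equality) auto
qed

text \<open>In Green's formula for the shifted solution and \<open>y\<close> both vectors are
  eigenvectors, so the left side is \<open>z - cnj \<nu>\<close> times their product. On the right,
  \<open>z\<close> enters only through the M-function.\<close>

lemma cinner_resolvent_eigenspaces:
  assumes z: "z \<in> resolvent_set TG" and x: "x \<in> eigenspace T \<mu>" and y: "y \<in> eigenspace T' \<nu>"
  shows "(z - cnj \<nu>) * (cinner x y + (z - \<mu>) * cinner (resolvent TG z x) y)
    = cinner (G x) (\<Gamma>t2 y) - cinner (M_function T G \<Gamma>2 z (G x)) (Gt y)"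
proof -
  let ?u = "x + (z - \<mu>) *\<^sub>C resolvent TG z x"
  note u = eigenspace_shift[OF z x]
  have "?u \<in> Domain T" "op_app T ?u = z *\<^sub>C ?u" "y \<in> Domain T'" "op_app T' y = \<nu> *\<^sub>C y"
    using u(1) y by (auto simp: eigenspace_def)
  then have "(z - cnj \<nu>) * cinner ?u y = cinner (G ?u) (\<Gamma>t2 y) - cinner (\<Gamma>2 ?u) (Gt y)"
    using green[of ?u y]
    by (simp add: cinner_scaleC_left cinner_scaleC_right left_diff_distrib)
  moreover have "\<Gamma>2 ?u = M_function T G \<Gamma>2 z (G x)"
    using M_function_eq[OF z u(1)] u(2) by simp
  ultimately show ?thesis
    by (simp add: u(2) cinner_add_left cinner_scaleC_left)
qed

text \<open>Under the assumption on \<open>cnj z0\<close> the resolvent of \<open>TG\<close> is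
  bounded near \<open>z0\<close>, and Riemann's theorem applies to each matrix element. This covers
  the position of \<open>z0\<close> where a division by \<open>z - cnj \<nu>\<close> or
  \<open>z - cnj \<epsilon>\<close> could degenerate.\<close>

lemma cinner_resolvent_has_limit_if_bounded:
  assumes ev: "\<forall>\<^sub>F z in at z0. z \<in> resolvent_set TG" and e: "cnj z0 \<in> resolvent_set TG'"
  shows "\<exists>l. ((\<lambda>z. cinner (resolvent TG z x) y) \<longlongrightarrow> l) (at z0)"
proof -
  obtain d C where d: "0 < d" "0 \<le> C" and C:
    "\<And>z x. z \<in> resolvent_set TG \<Longrightarrow> dist z z0 < d \<Longrightarrow> norm (resolvent TG z x) \<le> C * norm x"
    using resolvent_bounded_near_cnj[OF e, unfolded complex_cnj_cnj] by blast
  obtain r where r: "0 < r" "ball z0 r - {z0} \<subseteq> resolvent_set TG"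
    by (rule punctured_ball_subset[OF ev])
  have hol: "(\<lambda>z. cinner (resolvent TG z x) y) holomorphic_on ball z0 r - {z0}"
    by (rule holomorphic_on_subset[OF holomorphic_on_cinner_resolvent r(2)])
  have "\<forall>\<^sub>F z in at z0. z \<in> ball z0 d - {z0}"
    by (rule eventually_at_punctured) (use d in auto)
  then have "\<forall>\<^sub>F z in at z0. cmod (cinner (resolvent TG z x) y) \<le> C * norm x * norm y"
    using ev
  proof eventually_elim
    case (elim z)
    then have "norm (resolvent TG z x) \<le> C * norm x"
      by (intro C) (auto simp: dist_commute)
    then show ?case
      by (rule order_trans[OF cinner_cauchy_schwarz mult_right_mono]) simp
  qed
  then obtain g where g: "g holomorphic_on ball z0 r"
    "\<forall>z\<in>ball z0 r - {z0}. g z = cinner (resolvent TG z x) y"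
    using holomorphic_on_extend_bounded[OF hol] r(1) by auto
  have "((\<lambda>z. cinner (resolvent TG z x) y) \<longlongrightarrow> g z0) (at z0)"
  proof (rule Lim_transform_eventually)
    show "(g \<longlongrightarrow> g z0) (at z0)"
      using g(1) r(1) holomorphic_on_imp_continuous_on[of g "ball z0 r"]
      by (simp add: continuous_on_eq_continuous_at isCont_def)
    show "\<forall>\<^sub>F z in at z0. g z = cinner (resolvent TG z x) y"
      by (rule eventually_mono[OF eventually_at_punctured[of "ball z0 r"]]) (use r(1) g(2) in auto)
  qed
  then show ?thesis by blast
qed

lemma cinner_resolvent_has_limit:
  assumes ev: "\<forall>\<^sub>F z in at z0. z \<in> resolvent_set TG" and z0: "z0 \<notin> resolvent_set TG"
    and M: "\<And>f g. \<exists>l. ((\<lambda>z. cinner (M_function T G \<Gamma>2 z f) g) \<longlongrightarrow> l) (at z0)"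
    and \<mu>: "\<mu> \<in> resolvent_set TG" and \<nu>: "\<nu> \<in> resolvent_set TG'"
    and \<delta>: "\<delta> \<in> resolvent_set TG" and \<epsilon>: "\<epsilon> \<in> resolvent_set TG'"
    and x: "x \<in> eigenspace T \<mu>" and y: "y \<in> eigenspace T' \<nu>"
  shows "\<exists>l. ((\<lambda>z. cinner (resolvent TG z (resolvent TG \<delta> x)) (resolvent TG' \<epsilon> y)) \<longlongrightarrow> l) (at z0)"
proof (cases "cnj z0 \<in> resolvent_set TG'")
  case True
  then show ?thesis by (rule cinner_resolvent_has_limit_if_bounded[OF ev])
next
  case False
  \<comment> \<open>\<open>z0\<close> lies outside the resolvent set containing \<open>\<mu>\<close>
    and \<open>\<delta>\<close>, and \<open>cnj z0\<close> outside the one containing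
    \<open>\<nu>\<close> and \<open>\<epsilon>\<close>.\<close>
  have ne: "z0 \<noteq> \<mu>" "z0 \<noteq> \<delta>" "z0 \<noteq> cnj \<nu>" "z0 \<noteq> cnj \<epsilon>"
    using z0 \<mu> \<delta> False \<nu> \<epsilon> by auto
  have ev': "\<forall>\<^sub>F z in at z0. z \<in> resolvent_set TG \<and> z \<noteq> \<mu> \<and> z \<noteq> \<delta> \<and> z \<noteq> cnj \<nu> \<and> z \<noteq> cnj \<epsilon>"
    using ev by (intro eventually_conj eventually_neq_at_within)
  obtain m where m: "((\<lambda>z. cinner (M_function T G \<Gamma>2 z (G x)) (Gt y)) \<longlongrightarrow> m) (at z0)"
    using M by blast
  \<comment> \<open>\<open>k z\<close> is \<open>cinner_resolvent_eigenspaces\<close> solved for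
    \<open>cinner (resolvent TG z x) y\<close>.\<close>
  define k where "k z = ((cinner (G x) (\<Gamma>t2 y) - cinner (M_function T G \<Gamma>2 z (G x)) (Gt y))
    / (z - cnj \<nu>) - cinner x y) / (z - \<mu>)" for z
  define l where "l = ((cinner (G x) (\<Gamma>t2 y) - m) / (z0 - cnj \<nu>) - cinner x y) / (z0 - \<mu>)"
  have k: "(k \<longlongrightarrow> l) (at z0)"
    unfolding k_def l_def using ne by (intro tendsto_intros m) auto
  \<comment> \<open>Dividing by \<open>z - cnj \<epsilon>\<close> brings in the resolvent of
    \<open>TG'\<close> by the dual identity; dividing by \<open>z - \<delta>\<close> brings in the
    one at \<open>\<delta>\<close> by the resolvent identity.\<close>
  let ?f = "\<lambda>z. ((k z - cinner x (resolvent TG' \<epsilon> y)) / (z - cnj \<epsilon>)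
    - cinner (resolvent TG \<delta> x) (resolvent TG' \<epsilon> y)) / (z - \<delta>)"
  have lim: "(?f \<longlongrightarrow> ((l - cinner x (resolvent TG' \<epsilon> y)) / (z0 - cnj \<epsilon>)
    - cinner (resolvent TG \<delta> x) (resolvent TG' \<epsilon> y)) / (z0 - \<delta>)) (at z0)"
    using ne by (intro tendsto_intros k) auto
  show ?thesis
  proof (rule exI, rule Lim_transform_eventually[OF lim])
    show "\<forall>\<^sub>F z in at z0.
      ?f z = cinner (resolvent TG z (resolvent TG \<delta> x)) (resolvent TG' \<epsilon> y)"
      using ev'
    proof eventually_elim
      case (elim z)
      then have z: "z \<in> resolvent_set TG" by simp
      have "k z = cinner (resolvent TG z x) y"
        using elim by (simp add: k_def flip: cinner_resolvent_eigenspaces[OF z x y])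
      then have "(k z - cinner x (resolvent TG' \<epsilon> y)) / (z - cnj \<epsilon>)
          = cinner (resolvent TG z x) (resolvent TG' \<epsilon> y)"
        using elim by (simp flip: cinner_resolvent_resolvent[OF z \<epsilon>])
      moreover have "cinner (resolvent TG z x) (resolvent TG' \<epsilon> y)
          - cinner (resolvent TG \<delta> x) (resolvent TG' \<epsilon> y)
          = (z - \<delta>) * cinner (resolvent TG z (resolvent TG \<delta> x)) (resolvent TG' \<epsilon> y)"
        by (simp add: resolvent_identity[OF z \<delta>] cinner_scaleC_left flip: cinner_diff_left)
      ultimately show ?case using elim by simp
    qed
  qed
qed

end

section \<open>From boundary triplets to the compressed resolvent\<close>

lemma green_pair_boundary_triplet:
  fixes \<Gamma>1 \<Gamma>t2 :: "'a::chilbert_space \<Rightarrow> 'h::chilbert_space"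
    and \<Gamma>2 \<Gamma>t1 :: "'a \<Rightarrow> 'k::chilbert_space"
  assumes AAt: "adjoint_pair A At" and bt: "boundary_triplet A At \<Gamma>1 \<Gamma>2 \<Gamma>t1 \<Gamma>t2"
    and B: "bounded_clinear B"
  shows "green_pair (op_adjoint At) (op_adjoint A) \<Gamma>t2 \<Gamma>2
    (\<lambda>u. \<Gamma>1 u - B (\<Gamma>2 u)) (\<lambda>v. \<Gamma>t1 v - cadjoint B (\<Gamma>t2 v))"
proof
  show "linear_operator (op_adjoint At)" "linear_operator (op_adjoint A)"
    using AAt csubspace_op_adjoint single_valued_op_adjoint
    unfolding adjoint_pair_def linear_operator_def by blast+
  have "clinear_on (Domain (op_adjoint At)) \<Gamma>1" "clinear_on (Domain (op_adjoint At)) \<Gamma>2"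
    using bt by (auto simp: boundary_triplet_def graph_bounded_operator_def)
  then show "clinear_on (Domain (op_adjoint At)) (\<lambda>u. \<Gamma>1 u - B (\<Gamma>2 u))"
    by (simp add: clinear_on_def bounded_clinearD[OF B] complex_vector.scale_right_diff_distrib)
next
  fix u v assume "u \<in> Domain (op_adjoint At)" "v \<in> Domain (op_adjoint A)"
  then have "cinner (op_app (op_adjoint At) u) v - cinner u (op_app (op_adjoint A) v) =
      cinner (\<Gamma>1 u) (\<Gamma>t2 v) - cinner (\<Gamma>2 u) (\<Gamma>t1 v)"
    using bt unfolding boundary_triplet_def by blast
  \<comment> \<open>The two terms containing \<open>B\<close> and its adjoint cancel.\<close>
  then show "cinner (op_app (op_adjoint At) u) v - cinner u (op_app (op_adjoint A) v) =
      cinner (\<Gamma>1 u - B (\<Gamma>2 u)) (\<Gamma>t2 v) - cinner (\<Gamma>2 u) (\<Gamma>t1 v - cadjoint B (\<Gamma>t2 v))"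
    by (simp add: cinner_diff_left cinner_diff_right cinner_cadjoint[OF B])
qed

text \<open>The projections put both entries into the closures of the spans, where the limits yield
  a uniform bound and make \<open>z0\<close> removable. At a point of the resolvent set, local
  boundedness of the resolvent suffices instead.\<close>

lemma extends_analytically_compressed_resolvent:
  fixes T :: "('a::chilbert_space \<times> 'a) set"
  assumes ev: "\<forall>\<^sub>F z in at z0. z \<in> resolvent_set T"
    and lim: "\<And>x y. z0 \<notin> resolvent_set T \<Longrightarrow> x \<in> X \<Longrightarrow> y \<in> Y \<Longrightarrow>
      \<exists>l. ((\<lambda>z. cinner (resolvent T z x) y) \<longlongrightarrow> l) (at z0)"
  shows "extends_analytically_at
    (\<lambda>z. orth_proj (closure (cspan Y)) \<circ> resolvent T z \<circ> orth_proj (closure (cspan X)))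
    (resolvent_set T) z0"
proof -
  have XY: "csubspace (closure (cspan X))" "csubspace (closure (cspan Y))"
    using csubspace_closure complex_vector.subspace_span by blast+
  define P where "P = orth_proj (closure (cspan X))"
  define Q where "Q = orth_proj (closure (cspan Y))"
  define F where "F z = Q \<circ> resolvent T z \<circ> P" for z
  have PQ: "bounded_clinear P" "bounded_clinear Q" "\<And>x. norm (P x) \<le> norm x" "\<And>y. norm (Q y) \<le> norm y"
    "\<And>x. P x \<in> closure (cspan X)" "\<And>y. Q y \<in> closure (cspan Y)"
    unfolding P_def Q_def
    using bounded_clinear_orth_proj norm_orth_proj_le orth_proj_props(1) XY closed_closure by blast+
  have F: "bounded_clinear (F z)" if "z \<in> resolvent_set T" for z
    unfolding F_def using PQ bounded_clinear_resolvent[OF that] by (intro bounded_clinear_compose)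
  \<comment> \<open>Self-adjointness of \<open>Q\<close> moves the left projection to the second
    entry.\<close>
  have cinner_F: "cinner (F z x) y = cinner (resolvent T z (P x)) (Q y)" for z x y
    unfolding F_def Q_def comp_def by (rule cinner_orth_proj[OF XY(2) closed_closure])
  have hol: "(\<lambda>z. cinner (F z x) y) holomorphic_on V" if "V \<subseteq> resolvent_set T" for x y V
    unfolding cinner_F by (rule holomorphic_on_subset[OF holomorphic_on_cinner_resolvent that])
  have bound: "cmod (cinner (F z x) y) \<le> C * norm x * norm y"
    if "0 \<le> C" "cmod (cinner (resolvent T z (P x)) (Q y)) \<le> C * norm (P x) * norm (Q y)" for C z x y
  proof -
    have "C * norm (P x) * norm (Q y) \<le> C * norm x * norm y"
      using that(1) PQ(3,4) by (intro mult_mono) auto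
    then show ?thesis using that(2) cinner_F by simp
  qed
  obtain r where r: "0 < r" "ball z0 r - {z0} \<subseteq> resolvent_set T"
    by (rule punctured_ball_subset[OF ev])
  have "\<exists>U F'. z0 \<in> U \<and> op_analytic_on F' U \<and> (\<forall>z\<in>U \<inter> resolvent_set T. F' z = F z)"
  proof (cases "z0 \<in> resolvent_set T")
    case True
    obtain e C where e: "0 < e" "0 \<le> C"
      "\<And>w x. w \<in> resolvent_set T \<Longrightarrow> dist w z0 < e \<Longrightarrow> norm (resolvent T w x) \<le> C * norm x"
      using resolvent_locally_bounded[OF True] by blast
    define s where "s = min e r"
    have s: "0 < s" "ball z0 s \<subseteq> ball z0 e" "ball z0 s \<subseteq> resolvent_set T"
      using e(1) r True by (auto simp: s_def)
    have "op_analytic_on F (ball z0 (s/4))"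
    proof (rule op_analytic_on_if_weakly_holomorphic[OF s(1) e(2)])
      fix z x y assume z: "z \<in> ball z0 s"
      show "cmod (cinner (F z x) y) \<le> C * norm x * norm y"
      proof (rule bound[OF e(2)])
        have "norm (resolvent T z (P x)) \<le> C * norm (P x)"
          using z s(2,3) by (intro e(3)) (auto simp: dist_commute)
        then show "cmod (cinner (resolvent T z (P x)) (Q y)) \<le> C * norm (P x) * norm (Q y)"
          by (rule order_trans[OF cinner_cauchy_schwarz mult_right_mono]) simp
      qed
    qed (use F hol s(3) in blast)+
    then show ?thesis
      using s(1) by (intro exI[of _ "ball z0 (s/4)"] exI[of _ F]) simp
  next
    case False
    define s where "s = r / 2"
    have "cball z0 s \<subseteq> ball z0 r"
      using r(1) by (simp add: s_def cball_subset_ball_iff)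
    then have s: "0 < s" "cball z0 s - {z0} \<subseteq> resolvent_set T"
      using r by (auto simp: s_def)
    then have s': "ball z0 s - {z0} \<subseteq> resolvent_set T"
      using ball_subset_cball by blast
    obtain C where C: "0 \<le> C" "\<And>z x y. z \<in> ball z0 s - {z0} \<Longrightarrow> x \<in> closure (cspan X) \<Longrightarrow>
        y \<in> closure (cspan Y) \<Longrightarrow> cmod (cinner (resolvent T z x) y) \<le> C * norm x * norm y"
      using cinner_resolvent_bounded_if_limits[OF s, of X Y] lim[OF False] by blast
    have "\<exists>F'. op_analytic_on F' (ball z0 (s/4)) \<and> (\<forall>z. z \<noteq> z0 \<longrightarrow> F' z = F z)"
    proof (rule op_analytic_removable_singularity[OF s(1) C(1), of z0 F])
      show "bounded_clinear (F z)" if "z \<in> ball z0 s - {z0}" for z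
        using F s' that by blast
      show "(\<lambda>z. cinner (F z x) y) holomorphic_on ball z0 s - {z0}" for x y
        by (rule hol[OF s'])
      show "cmod (cinner (F z x) y) \<le> C * norm x * norm y" if "z \<in> ball z0 s - {z0}" for z x y
        by (rule bound[OF C(1) C(2)[OF that PQ(5,6)]])
    qed
    then obtain F' where F': "op_analytic_on F' (ball z0 (s/4))" "\<And>z. z \<noteq> z0 \<Longrightarrow> F' z = F z"
      by metis
    \<comment> \<open>The extension may alter \<open>F\<close> only at \<open>z0\<close>, which in
      this case is not in the resolvent set.\<close>
    have "F' z = F z" if "z \<in> resolvent_set T" for z
      by (rule F'(2)) (use that False in auto)
    then show ?thesis
      using F'(1) s(1) by (intro exI[of _ "ball z0 (s/4)"] exI[of _ F']) simp
  qed
  then show ?thesis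
    unfolding extends_analytically_at_def F_def P_def Q_def .
qed

theorem theorem3p6:
  fixes A At AB AtB :: "('a::chilbert_space \<times> 'a) set"
    and \<Gamma>1 \<Gamma>t2 :: "'a \<Rightarrow> 'h::chilbert_space"
    and \<Gamma>2 \<Gamma>t1 :: "'a \<Rightarrow> 'k::chilbert_space"
    and B :: "'k \<Rightarrow> 'h"
    and G :: "'a \<Rightarrow> 'h" and Gt :: "'a \<Rightarrow> 'k"
    and \<mu>0 \<mu>t z0 :: complex
    and S St :: "'a set"
  assumes "adjoint_pair A At"
    and "boundary_triplet A At \<Gamma>1 \<Gamma>2 \<Gamma>t1 \<Gamma>t2"
    and "bounded_clinear B"
    and "G = (\<lambda>u. \<Gamma>1 u - B (\<Gamma>2 u))"
    and "Gt = (\<lambda>v. \<Gamma>t1 v - cadjoint B (\<Gamma>t2 v))"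
    and "AB = restrict_ker (op_adjoint At) G"
    and "AtB = restrict_ker (op_adjoint A) Gt"
    and "resolvent_set AB \<noteq> {}"
    and "\<mu>0 \<notin> op_spectrum AB"
    and "\<mu>t \<notin> op_spectrum AtB"
    and "S = cspan (\<Union>\<delta> \<in> - op_spectrum AB.
               resolvent AB \<delta> ` solution_range (op_adjoint At) G \<mu>0)"
    and "St = cspan (\<Union>\<delta> \<in> - op_spectrum AtB.
               resolvent AtB \<delta> ` solution_range (op_adjoint A) Gt \<mu>t)"
    and "point_of_analyticity (M_function (op_adjoint At) G \<Gamma>2) (resolvent_set AB) z0"
    and "\<forall>\<^sub>F z in at z0. z \<in> resolvent_set AB"
    and "finite (components (resolvent_set AtB))"
  shows "extends_analytically_at
           (\<lambda>z. orth_proj (closure St) \<circ> resolvent AB z \<circ> orth_proj (closure S))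
           (resolvent_set AB) z0"
proof -
  let ?T = "op_adjoint At" and ?T' = "op_adjoint A"
  let ?R = "resolvent_set AB"
  interpret green_pair ?T ?T' \<Gamma>t2 \<Gamma>2 G Gt
    unfolding assms(4,5) by (rule green_pair_boundary_triplet[OF assms(1-3)])
  have mu: "\<mu>0 \<in> ?R" "\<mu>t \<in> resolvent_set AtB"
    using assms(9,10) by (auto simp: op_spectrum_def)
  obtain U F where UF: "z0 \<in> U" "op_analytic_on F U"
    "\<And>z. z \<in> U \<inter> ?R \<Longrightarrow> F z = M_function ?T G \<Gamma>2 z"
    using assms(13) unfolding point_of_analyticity_def by blast
  \<comment> \<open>The function \<open>F\<close> is strongly continuous at \<open>z0\<close> and
    equals the M-function on a punctured neighbourhood, so the matrix elements of the latter tend to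
    those of \<open>F z0\<close>.\<close>
  have M: "\<exists>l. ((\<lambda>z. cinner (M_function ?T G \<Gamma>2 z f) g) \<longlongrightarrow> l) (at z0)" for f g
  proof -
    have "\<forall>\<^sub>F z in at z0. z \<in> U - {z0}"
      using UF by (intro eventually_at_punctured) (auto simp: op_analytic_on_def)
    then have "\<forall>\<^sub>F z in at z0. cinner (F z f) g = cinner (M_function ?T G \<Gamma>2 z f) g"
      using assms(14) by eventually_elim (simp add: UF(3))
    from Lim_transform_eventually[OF tendsto_cinner_left[OF op_analytic_on_tendsto[OF UF(2,1)]] this]
    show ?thesis by blast
  qed
  have "extends_analytically_at
      (\<lambda>z. orth_proj (closure St) \<circ> resolvent AB z \<circ> orth_proj (closure S)) ?R z0"
    unfolding assms(11,12)
  proof (rule extends_analytically_compressed_resolvent[OF assms(14)])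
    \<comment> \<open>Limits are needed only for generators of \<open>S\<close> and
      \<open>St\<close>, and only when \<open>z0\<close> is a spectral point.\<close>
    fix x y
    assume z0: "z0 \<notin> ?R"
      and "x \<in> (\<Union>\<delta> \<in> - op_spectrum AB. resolvent AB \<delta> ` solution_range ?T G \<mu>0)"
      and "y \<in> (\<Union>\<epsilon> \<in> - op_spectrum AtB. resolvent AtB \<epsilon> ` solution_range ?T' Gt \<mu>t)"
    then obtain \<delta> \<epsilon> u v where \<delta>: "\<delta> \<in> ?R" and \<epsilon>: "\<epsilon> \<in> resolvent_set AtB"
      and uv: "u \<in> solution_range ?T G \<mu>0" "v \<in> solution_range ?T' Gt \<mu>t"
      and xy: "x = resolvent AB \<delta> u" "y = resolvent AtB \<epsilon> v"
      by (auto simp: op_spectrum_def)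
    have "u \<in> eigenspace ?T \<mu>0" "v \<in> eigenspace ?T' \<mu>t"
      using uv solution_range_subset by blast+
    then show "\<exists>l. ((\<lambda>z. cinner (resolvent AB z x) y) \<longlongrightarrow> l) (at z0)"
      unfolding xy
      by (rule cinner_resolvent_has_limit[folded assms(6,7), OF assms(14) z0 M mu \<delta> \<epsilon>])
  qed
  then show ?thesis .
qed

end
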